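(* Suppose there are constants $C_1,C_2,C_3,C_4>0$ and $t_1,t_2,t_3,t_4\ge0$ such that, for all sufficiently small $h>0$, $$C_1h^{t_1}\exp\big[-C_2(1/h)^{t_2}(\log(1/h))^{t_3}\big]\le\phi(\mathbf{x},h)\le C_3h^{t_4}\exp\big[-C_4(1/h)^{t_2}(\log(1/h))^{t_3}\big],$$ and that either $t_2>0$, or $t_3>1$ and $C_2=C_4$. Let $m(h)=C_2(1/h)^{t_2}(\log(1/h))^{t_3}$ for $0<h<1$, with inverse function $m^{-1}$. Assume: (1) there are constants $0<l\le L$ with $l\le K(u)\le L$ for $0\le u\le1$, and $K(u)=0$ for $u>1$; (2) $h_n>0$, $h_n\to0$ and $n\phi(\mathbf{x},h_n)\to\infty$ as $n\to\infty$; (3) for some $\beta>0$, $b_F>0$, $\|F(\mathbf{z})-F(\mathbf{x})\|\le b_F\,d(\mathbf{x},\mathbf{z})^\beta$ for all $\mathbf{z}$ in a neighborhood of $\mathbf{x}$; (4) for some $\nu>2$, $\mathbb{E}\big[\|G(\mathbf{Y})-\mathbb{E}[G(\mathbf{Y})\mid\mathbf{X}=\mathbf{z}]\|^\nu\mid\mathbf{X}=\mathbf{z}\big]$ is uniformly bounded for $\mathbf{z}$ in a neighborhood of $\mathbf{x}$; (5) $\widehat{\Theta}_n(\mathbf{x})-\Theta(\mathbf{x})=B_n(\mathbf{x})+V_n(\mathbf{x})+R_n(\mathbf{x})$ with $R_n(\mathbf{x})=o_{\mathbb{P}}(\delta_n)$, $\delta_n=\max\{h_n^\beta,[n\phi(\mathbf{x},h_n)]^{-1/2}\}$;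 (6) $\Theta(\cdot)$, with its corresponding $\mathbb{L}_{\mathbf{x}}$ and $F$, is such that there is a constant $b_1>0$ such that for any bandwidth sequence $\{h_n'\}$ with $h_n'\to0$ and $n\phi(\mathbf{x},h_n')\to\infty$ one has $(h_n')^{-\beta}\|\tilde{B}_n(\mathbf{x})\|>b_1$ for all sufficiently large $n$, where $\tilde{B}_n(\mathbf{x})$ is computed with bandwidth $h_n'$; (7) for some positive integer $i_0$, the function $\mathbb{V}(\mathbf{z})=\mathbb{E}\big[\big(\tilde{\phi}_{i_0}(\mathbb{L}_{\mathbf{x}}(G(\mathbf{Y})-\mathbb{E}[G(\mathbf{Y})\mid\mathbf{X}=\mathbf{z}]))\big)^2\,\big|\,\mathbf{X}=\mathbf{z}\big]$ converges to $\mathbb{V}(\mathbf{x})$ as $\mathbf{z}\to\mathbf{x}$, and $\mathbb{V}(\mathbf{x})>0$. Then there is a constant $c>0$ (depending on $\Theta(\mathbf{x})$) such that $$\liminf_{n\to\infty}\mathbb{P}\Big[(m^{-1}(\log n))^{-\beta}\big\|\widehat{\Theta}_n(\mathbf{x})-\Theta(\mathbf{x})\big\|>c\Big]>0.$$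
   Context: $(\mathcal{C},d)$ is a complete separable metric space, $\mathcal{R}$ is a measurable space, $(\mathbf{X},\mathbf{Y})$ is a random element of $\mathcal{C}\times\mathcal{R}$, and $(\mathbf{X}_i,\mathbf{Y}_i)$, $i\ge1$, are i.i.d. copies. A regular conditional distribution of $\mathbf{Y}$ given $\mathbf{X}=\mathbf{z}$ is fixed and $\mathbb{E}[\,\cdot\mid\mathbf{X}=\mathbf{z}]$ is taken with respect to it; Banach-space-valued expectations are in the Bochner sense. $\mathbf{x}\in\mathcal{C}$ is fixed and $\phi(\mathbf{x},h)=\mathbb{P}[d(\mathbf{x},\mathbf{X})\le h]$. $K:[0,\infty)\to[0,\infty)$ is a measurable kernel; bandwidths are positive and deterministic. $\mathcal{B}$ is a separable Banach space of type 2 (there is $c_0>0$ with $\mathbb{E}\|\sum_{i\le n}\mathbf{Z}_i\|^2\le c_0\sum_{i\le n}\mathbb{E}\|\mathbf{Z}_i\|^2$ for all $n$ and all independent zero-mean $\mathbf{Z}_i$ with finite second moments) with a Schauder basis $\{\mathbf{e}_1,\mathbf{e}_2,\dots\}$; $\tilde{\phi}_i\in\mathcal{B}^*$ are the coordinate functionals, so $\mathbf{v}=\sum_i\tilde{\phi}_i(\mathbf{v})\mathbf{e}_i$ for all $\mathbf{v}\in\mathcal{B}$. $\mathcal{G}$ is a separable Banach space, $F:\mathcal{C}\to\mathcal{G}$ and $G:\mathcal{R}\to\mathcal{G}$ are measurable, $\mathbb{L}_{\mathbf{x}}:\mathcal{G}\to\mathcal{B}$ is continuous linear. The parameter $\Theta(\mathbf{x})\in\mathcal{B}$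 is a functional of the conditional distribution of $\mathbf{Y}$ given $\mathbf{X}=\mathbf{x}$, and $\widehat{\Theta}_n(\mathbf{x})$ is the same functional of the weighted empirical measure putting mass $K(h_n^{-1}d(\mathbf{x},\mathbf{X}_i))/\sum_jK(h_n^{-1}d(\mathbf{x},\mathbf{X}_j))$ at $\mathbf{Y}_i$. Here $$B_n(\mathbf{x})=\mathbb{L}_{\mathbf{x}}\left(\frac{\sum_{i=1}^{n}F(\mathbf{X}_i)K(h_n^{-1}d(\mathbf{x},\mathbf{X}_i))}{\sum_{i=1}^{n}K(h_n^{-1}d(\mathbf{x},\mathbf{X}_i))}-F(\mathbf{x})\right),$$ $$V_n(\mathbf{x})=\mathbb{L}_{\mathbf{x}}\left(\frac{\sum_{i=1}^{n}\big[G(\mathbf{Y}_i)-\mathbb{E}[G(\mathbf{Y}_i)\mid\mathbf{X}_i]\big]K(h_n^{-1}d(\mathbf{x},\mathbf{X}_i))}{\sum_{i=1}^{n}K(h_n^{-1}d(\mathbf{x},\mathbf{X}_i))}\right),$$ $$\tilde{B}_n(\mathbf{x})=\mathbb{L}_{\mathbf{x}}\left(\mathbb{E}\left[(F(\mathbf{X})-F(\mathbf{x}))\frac{K(h_n^{-1}d(\mathbf{x},\mathbf{X}))}{\mathbb{E}[K(h_n^{-1}d(\mathbf{x},\mathbf{X}))]}\right]\right),$$ and quotients with zero denominator are read as $0$. The function $m$ is strictly decreasing on $(0,1)$ with $m(h)\to\infty$ as $h\to0^+$, so $m^{-1}(\log n)$ is defined for all large $n$. *)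

theory Defs
  imports "HOL-Probability.Probability"
begin

section \<open>Banach spaces of type 2 and Schauder bases\<close>

text \<open>
  The sample space \<^typ>\<open>nat \<Rightarrow> 'b\<close> is rich enough to carry any sequence of random elements of
  \<^typ>\<open>'b\<close>; lemma \<open>type_2_bound\<close> below recovers the inequality on every probability space.
\<close>

definition type_2 :: "'b::{banach, second_countable_topology} itself \<Rightarrow> bool" where
  "type_2 _ \<longleftrightarrow> (\<exists>c0>0. \<forall>n (P :: (nat \<Rightarrow> 'b) measure) (Z :: nat \<Rightarrow> (nat \<Rightarrow> 'b) \<Rightarrow> 'b).
     prob_space P \<longrightarrow>
     prob_space.indep_vars P (\<lambda>_. borel) Z {1..n} \<longrightarrow>
     (\<forall>i\<in>{1..n}. integrable P (\<lambda>\<omega>. (norm (Z i \<omega>))\<^sup>2) \<and> (\<integral>\<omega>. Z i \<omega> \<partial>P) = 0) \<longrightarrow>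
     (\<integral>\<omega>. (norm (\<Sum>i=1..n. Z i \<omega>))\<^sup>2 \<partial>P) \<le> c0 * (\<Sum>i=1..n. \<integral>\<omega>. (norm (Z i \<omega>))\<^sup>2 \<partial>P))"

lemma type_2_bound:
  assumes "type_2 TYPE('b::{banach, second_countable_topology})"
  obtains c0 :: real where "c0 > 0"
    "\<And>n (M :: 'w measure) (Z :: nat \<Rightarrow> 'w \<Rightarrow> 'b).
       prob_space M \<Longrightarrow> prob_space.indep_vars M (\<lambda>_. borel) Z {1..n} \<Longrightarrow>
       (\<And>i. i \<in> {1..n} \<Longrightarrow> integrable M (\<lambda>\<omega>. (norm (Z i \<omega>))\<^sup>2)) \<Longrightarrow>
       (\<And>i. i \<in> {1..n} \<Longrightarrow> (\<integral>\<omega>. Z i \<omega> \<partial>M) = 0) \<Longrightarrow>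
       (\<integral>\<omega>. (norm (\<Sum>i=1..n. Z i \<omega>))\<^sup>2 \<partial>M) \<le> c0 * (\<Sum>i=1..n. \<integral>\<omega>. (norm (Z i \<omega>))\<^sup>2 \<partial>M)"
proof -
  obtain c0 :: real where c0: "c0 > 0" and
    bd: "\<And>n (P :: (nat \<Rightarrow> 'b) measure) (Z :: nat \<Rightarrow> (nat \<Rightarrow> 'b) \<Rightarrow> 'b).
     prob_space P \<Longrightarrow>
     prob_space.indep_vars P (\<lambda>_. borel) Z {1..n} \<Longrightarrow>
     (\<forall>i\<in>{1..n}. integrable P (\<lambda>\<omega>. (norm (Z i \<omega>))\<^sup>2) \<and> (\<integral>\<omega>. Z i \<omega> \<partial>P) = 0) \<Longrightarrow>
     (\<integral>\<omega>. (norm (\<Sum>i=1..n. Z i \<omega>))\<^sup>2 \<partial>P) \<le> c0 * (\<Sum>i=1..n. \<integral>\<omega>. (norm (Z i \<omega>))\<^sup>2 \<partial>P)"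
    using assms unfolding type_2_def by blast
  show thesis
  proof (rule that[OF c0])
    fix n and M :: "'w measure" and Z :: "nat \<Rightarrow> 'w \<Rightarrow> 'b"
    assume M: "prob_space M" and ind: "prob_space.indep_vars M (\<lambda>_. borel) Z {1..n}"
      and sq: "\<And>i. i \<in> {1..n} \<Longrightarrow> integrable M (\<lambda>\<omega>. (norm (Z i \<omega>))\<^sup>2)"
      and mean: "\<And>i. i \<in> {1..n} \<Longrightarrow> (\<integral>\<omega>. Z i \<omega> \<partial>M) = 0"
    interpret prob_space M by fact
    have Zm: "Z i \<in> borel_measurable M" if "i \<in> {1..n}" for i
      using ind that unfolding indep_vars_def by auto
    define W where "W = (\<lambda>\<omega> i. if i \<in> {1..n} then Z i \<omega> else 0)"
    define S where "S = (\<Pi>\<^sub>M i\<in>(UNIV::nat set). (borel :: 'b measure))"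
    have W[measurable]: "W \<in> M \<rightarrow>\<^sub>M S"
    proof -
      have "(\<lambda>\<omega>. W \<omega> i) \<in> borel_measurable M" for i
        by (cases "i \<in> {1..n}") (simp_all only: W_def if_True if_False Zm borel_measurable_const)
      then show ?thesis
        unfolding S_def by (intro measurable_PiM_single') (auto simp: W_def)
    qed
    have cm[measurable]: "(\<lambda>f. f i) \<in> S \<rightarrow>\<^sub>M borel" for i
      unfolding S_def by measurable
    define P where "P = distr M S W"
    have P: "prob_space P" unfolding P_def by (rule prob_space_distr[OF W])
    have comp: "W \<omega> i = Z i \<omega>" if "i \<in> {1..n}" for i \<omega> using that by (simp add: W_def)
    have cP: "distr P borel (\<lambda>f. f i) = distr M borel (Z i)" if "i \<in> {1..n}" for i
      unfolding P_def by (subst distr_distr) (auto simp: comp_def comp[OF that] intro!: distr_cong)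
    have indP: "prob_space.indep_vars P (\<lambda>_. borel) (\<lambda>i f. f i) {1..n}"
    proof (cases "n = 0")
      case True
      then show ?thesis
        by (simp add: prob_space.indep_vars_def[OF P] prob_space.indep_sets_def[OF P])
    next
      case False
      have r: "(\<lambda>f. \<lambda>i\<in>{1..n}. f i) \<in> S \<rightarrow>\<^sub>M (\<Pi>\<^sub>M i\<in>{1..n}. borel)"
        by (rule measurable_restrict) measurable
      have "distr P (\<Pi>\<^sub>M i\<in>{1..n}. borel) (\<lambda>f. \<lambda>i\<in>{1..n}. f i)
          = distr M (\<Pi>\<^sub>M i\<in>{1..n}. borel) (\<lambda>\<omega>. \<lambda>i\<in>{1..n}. Z i \<omega>)"
        unfolding P_def by (subst distr_distr[OF r W])
          (auto intro!: distr_cong simp: comp_def W_def restrict_def fun_eq_iff)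
      also have "\<dots> = (\<Pi>\<^sub>M i\<in>{1..n}. distr M borel (Z i))"
        using ind False Zm by (subst (asm) indep_vars_iff_distr_eq_PiM'[of "{1..n}" Z]) auto
      also have "\<dots> = (\<Pi>\<^sub>M i\<in>{1..n}. distr P borel (\<lambda>f. f i))"
        by (intro PiM_cong) (simp_all add: cP)
      finally show ?thesis
        using False by (subst prob_space.indep_vars_iff_distr_eq_PiM'[OF P]) (auto simp: P_def)
    qed
    have "(\<integral>f. (norm (\<Sum>i=1..n. f i))\<^sup>2 \<partial>P) \<le> c0 * (\<Sum>i=1..n. \<integral>f. (norm (f i))\<^sup>2 \<partial>P)"
    proof (rule bd[OF P indP], intro ballI conjI)
      fix i assume i: "i \<in> {1..n}"
      show "integrable P (\<lambda>f. (norm (f i))\<^sup>2)"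
        unfolding P_def using sq[OF i] by (subst integrable_distr_eq) (auto simp: comp[OF i])
      show "(\<integral>f. f i \<partial>P) = 0"
        unfolding P_def using mean[OF i] by (subst integral_distr) (auto simp: comp[OF i])
    qed
    moreover have "(\<integral>f. (norm (\<Sum>i=1..n. f i))\<^sup>2 \<partial>P) = (\<integral>\<omega>. (norm (\<Sum>i=1..n. Z i \<omega>))\<^sup>2 \<partial>M)"
      unfolding P_def by (subst integral_distr) (auto simp: comp)
    moreover have "(\<Sum>i=1..n. \<integral>f. (norm (f i))\<^sup>2 \<partial>P) = (\<Sum>i=1..n. \<integral>\<omega>. (norm (Z i \<omega>))\<^sup>2 \<partial>M)"
      unfolding P_def by (intro sum.cong refl, subst integral_distr) (auto simp: comp)
    ultimately show "(\<integral>\<omega>. (norm (\<Sum>i=1..n. Z i \<omega>))\<^sup>2 \<partial>M)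
        \<le> c0 * (\<Sum>i=1..n. \<integral>\<omega>. (norm (Z i \<omega>))\<^sup>2 \<partial>M)" by simp
  qed
qed

text \<open>
  Bases are numbered \<open>1, 2, \<dots>\<close> up to \<open>d\<close>. The case \<open>d = \<infinity>\<close> is a Schauder basis in an
  infinite-dimensional space; finite \<open>d\<close> covers finite-dimensional spaces.
\<close>

definition basis_index :: "enat \<Rightarrow> nat set" where
  "basis_index d = {i. 1 \<le> i \<and> enat i \<le> d}"

definition schauder_basis :: "enat \<Rightarrow> (nat \<Rightarrow> 'b::banach) \<Rightarrow> bool" where
  "schauder_basis d e \<longleftrightarrow>
     (\<forall>v. \<exists>!a :: nat \<Rightarrow> real. (\<forall>i. i \<notin> basis_index d \<longrightarrow> a i = 0) \<and> (\<lambda>i. a i *\<^sub>R e i) sums v)"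

definition coordinate_functionals ::
    "enat \<Rightarrow> (nat \<Rightarrow> 'b::banach) \<Rightarrow> (nat \<Rightarrow> 'b \<Rightarrow>\<^sub>L real) \<Rightarrow> bool" where
  "coordinate_functionals d e \<psi> \<longleftrightarrow>
     (\<forall>v. (\<lambda>i. if i \<in> basis_index d then blinfun_apply (\<psi> i) v *\<^sub>R e i else 0) sums v)"


section \<open>Conditional distributions and small balls\<close>

definition regular_cond_distr ::
    "'w measure \<Rightarrow> ('w \<Rightarrow> 'c::polish_space) \<Rightarrow> ('w \<Rightarrow> 'r) \<Rightarrow> 'r measure \<Rightarrow> ('c \<Rightarrow> 'r measure) \<Rightarrow> bool"
where
  "regular_cond_distr M X Y N \<kappa> \<longleftrightarrow>
     \<kappa> \<in> borel \<rightarrow>\<^sub>M prob_algebra N \<and>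
     (\<forall>A\<in>sets borel. \<forall>B\<in>sets N.
        emeasure M {\<omega>\<in>space M. X \<omega> \<in> A \<and> Y \<omega> \<in> B}
          = (\<integral>\<^sup>+z\<in>A. emeasure (\<kappa> z) B \<partial>distr M borel X))"

definition small_ball :: "'w measure \<Rightarrow> ('w \<Rightarrow> 'c::polish_space) \<Rightarrow> 'c \<Rightarrow> real \<Rightarrow> real" where
  "small_ball M X x h = measure M {\<omega>\<in>space M. dist x (X \<omega>) \<le> h}"

definition ball_exponent :: "real \<Rightarrow> real \<Rightarrow> real \<Rightarrow> real \<Rightarrow> real" where
  "ball_exponent C s t h = C * (1 / h) powr s * (ln (1 / h)) powr t"

definition ball_exponent_inv :: "real \<Rightarrow> real \<Rightarrow> real \<Rightarrow> real \<Rightarrow> real" where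
  "ball_exponent_inv C s t = the_inv_into {0<..<1} (ball_exponent C s t)"


section \<open>Kernel estimator and its expansion\<close>

text \<open>
  Below, \<open>xs\<close> and \<open>ys\<close> are the realised samples \<open>X\<^sub>1, X\<^sub>2, \<dots>\<close> and \<open>Y\<^sub>1, Y\<^sub>2, \<dots>\<close>. Quotients with
  zero denominator are \<open>0\<close> by the conventions for \<open>/\<close> and \<open>/\<^sub>R\<close>; the weighted empirical measure
  is then the null measure.
\<close>

definition kernel_weight :: "(real \<Rightarrow> real) \<Rightarrow> 'c::polish_space \<Rightarrow> real \<Rightarrow> 'c \<Rightarrow> real" where
  "kernel_weight K x h z = K (inverse h * dist x z)"

definition kernel_average ::
    "(real \<Rightarrow> real) \<Rightarrow> 'c::polish_space \<Rightarrow> real \<Rightarrow> nat \<Rightarrow> (nat \<Rightarrow> 'c) \<Rightarrow> (nat \<Rightarrow> 'g) \<Rightarrow> 'g::real_vector"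
where
  "kernel_average K x h n xs v =
     (\<Sum>i=1..n. kernel_weight K x h (xs i) *\<^sub>R v i) /\<^sub>R (\<Sum>i=1..n. kernel_weight K x h (xs i))"

definition weighted_empirical ::
    "'r measure \<Rightarrow> (real \<Rightarrow> real) \<Rightarrow> 'c::polish_space \<Rightarrow> real \<Rightarrow> nat \<Rightarrow> (nat \<Rightarrow> 'c) \<Rightarrow> (nat \<Rightarrow> 'r) \<Rightarrow> 'r measure"
where
  "weighted_empirical N K x h n xs ys =
     distr (point_measure {1..n}
              (\<lambda>i. ennreal (kernel_weight K x h (xs i) / (\<Sum>j=1..n. kernel_weight K x h (xs j))))) N ys"

definition bias_term ::
    "('g::{banach, second_countable_topology} \<Rightarrow>\<^sub>L 'b::{banach, second_countable_topology}) \<Rightarrow> ('c \<Rightarrow> 'g) \<Rightarrow>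
     (real \<Rightarrow> real) \<Rightarrow> 'c::polish_space \<Rightarrow> real \<Rightarrow> nat \<Rightarrow> (nat \<Rightarrow> 'c) \<Rightarrow> 'b"
where
  "bias_term L F K x h n xs = blinfun_apply L (kernel_average K x h n xs (\<lambda>i. F (xs i)) - F x)"

definition noise_term ::
    "('g::{banach, second_countable_topology} \<Rightarrow>\<^sub>L 'b::{banach, second_countable_topology}) \<Rightarrow> ('r \<Rightarrow> 'g) \<Rightarrow>
     ('c \<Rightarrow> 'r measure) \<Rightarrow>
     (real \<Rightarrow> real) \<Rightarrow> 'c::polish_space \<Rightarrow> real \<Rightarrow> nat \<Rightarrow> (nat \<Rightarrow> 'c) \<Rightarrow> (nat \<Rightarrow> 'r) \<Rightarrow> 'b"
where
  "noise_term L G \<kappa> K x h n xs ys =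
     blinfun_apply L (kernel_average K x h n xs (\<lambda>i. G (ys i) - (\<integral>y. G y \<partial>\<kappa> (xs i))))"

definition mean_bias ::
    "'w measure \<Rightarrow> ('w \<Rightarrow> 'c::polish_space) \<Rightarrow>
     ('g::{banach, second_countable_topology} \<Rightarrow>\<^sub>L 'b::{banach, second_countable_topology}) \<Rightarrow> ('c \<Rightarrow> 'g) \<Rightarrow>
     (real \<Rightarrow> real) \<Rightarrow> 'c \<Rightarrow> real \<Rightarrow> 'b"
where
  "mean_bias M X L F K x h =
     blinfun_apply L (\<integral>\<omega>. (kernel_weight K x h (X \<omega>) / (\<integral>\<omega>'. kernel_weight K x h (X \<omega>') \<partial>M))
                            *\<^sub>R (F (X \<omega>) - F x) \<partial>M)"

definition cond_coord_variance ::
    "('b \<Rightarrow>\<^sub>L real) \<Rightarrow>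
     ('g::{banach, second_countable_topology} \<Rightarrow>\<^sub>L 'b::{banach, second_countable_topology}) \<Rightarrow>
     ('r \<Rightarrow> 'g) \<Rightarrow> ('c \<Rightarrow> 'r measure) \<Rightarrow> 'c \<Rightarrow> real"
where
  "cond_coord_variance \<psi> L G \<kappa> z =
     (\<integral>y. (blinfun_apply \<psi> (blinfun_apply L (G y - (\<integral>y'. G y' \<partial>\<kappa> z))))\<^sup>2 \<partial>\<kappa> z)"

definition little_o_prob ::
    "'w measure \<Rightarrow> (nat \<Rightarrow> 'w \<Rightarrow> 'b::{banach, second_countable_topology}) \<Rightarrow> (nat \<Rightarrow> real) \<Rightarrow> bool" where
  "little_o_prob M R \<delta> \<longleftrightarrow>
     (\<forall>n. R n \<in> borel_measurable M) \<and>
     (\<forall>\<epsilon>>0. (\<lambda>n. measure M {\<omega>\<in>space M. norm (R n \<omega>) > \<epsilon> * \<delta> n}) \<longlonglongrightarrow> 0)"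

end

theory Submission
  imports Defs
begin

text \<open>
  With \<open>k\<^sub>i\<close> the kernel weights, the bias and noise terms add up to \<open>S / D\<close>, where \<open>D = \<Sum> k\<^sub>i\<close> and
  \<open>S = \<Sum> k\<^sub>i L (F X\<^sub>i - F x + G Y\<^sub>i - E[G Y\<^sub>i | X\<^sub>i])\<close> is a sum of i.i.d. elements. By Markov's inequality
  \<open>D\<close> has order at most \<open>n \<phi>(h\<^sub>n)\<close>, so it suffices that \<open>\<parallel>S\<parallel>\<close> is at least of order \<open>n \<phi>(h\<^sub>n) \<delta>\<^sub>n\<close> with
  probability bounded away from zero. If \<open>h\<^sub>n\<^sup>\<beta>\<close> is large compared to \<open>(n \<phi>(h\<^sub>n)) powr (-1/2)\<close>, the mean of
  \<open>S\<close> dominates its fluctuations, which the type 2 inequality bounds. Otherwise one coordinate of \<open>S\<close>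
  already suffices: at \<open>t = (n \<phi>(h\<^sub>n)) powr (-1/2)\<close> its characteristic function stays away from 1 in
  modulus, however \<open>S\<close> is centred, so the coordinate cannot concentrate near \<open>0\<close>. Hence the error is
  at least of order \<open>\<delta>\<^sub>n \<ge> h\<^sub>n\<^sup>\<beta>\<close>. Finally \<open>n \<phi>(h\<^sub>n) \<rightarrow> \<infinity>\<close> and the upper small ball bound force
  \<open>h\<^sub>n \<ge> a m\<inverse>(ln n)\<close> for some \<open>a > 0\<close>.
\<close>

section \<open>Small ball exponents and bandwidths\<close>

text \<open>Bias and noise may be of the same order and point in opposite directions, so neither can
  be bounded below alone. Merging them into one sum removes this obstacle: the modulus of a
  characteristic function is unchanged by a shift, so the mean of the sum cannot undo the spread
  created by the conditional variance of the noise. The law of a summand changes with the bandwidth,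
  so a central limit theorem for a fixed law does not apply; what is needed are bounds whose
  constants depend on moments only. All these moments have the order of the small ball probability,
  because the kernel is bounded and vanishes outside the ball. The ratio \<open>\<rho>\<close> of
  the two rates that separates the regimes is dictated by the bias regime; the other regime works
  below any finite threshold, so no gap is left between them. Numerator and denominator are
  dependent and are combined by a union bound only. A mismatch of \<open>C2\<close> and
  \<open>C4\<close> in the small ball bounds is absorbed in the factor \<open>a\<close>.\<close>

lemma ball_exponent_exp:
  "ball_exponent C s t (exp (- u)) = C * exp (s * u) * u powr t"
  by (simp add: ball_exponent_def exp_minus powr_def field_simps)

text \<open>For radii below 1 both \<open>1 / h\<close> and \<open>ln (1 / h)\<close> are positive
  and decrease in \<open>h\<close>; each power is weakly decreasing, and one with a positive
  exponent strictly so.\<close>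

lemma ball_exponent_strict_antimono:
  assumes "C > 0" "s \<ge> 0" "t \<ge> 0" "s > 0 \<or> t > 0" "0 < u" "u < v" "v < 1"
  shows "ball_exponent C s t v < ball_exponent C s t u"
proof -
  have inv: "1 < 1 / v" "1 / v < 1 / u"
    using assms by (auto simp: field_simps)
  have ln: "0 < ln (1 / v)" "ln (1 / v) < ln (1 / u)"
    using inv assms by (simp_all add: ln_less_cancel_iff del: ln_div)
  have le: "(1 / v) powr s \<le> (1 / u) powr s" "ln (1 / v) powr t \<le> ln (1 / u) powr t"
    using inv ln assms by (auto intro!: powr_mono2 simp del: ln_div)
  have pos: "0 < (1 / v) powr s" "0 < ln (1 / v) powr t" "0 < (1 / u) powr s"
    using inv ln assms by auto
  have "(1 / v) powr s * ln (1 / v) powr t < (1 / u) powr s * ln (1 / u) powr t"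
    using assms(4)
  proof
    assume "s > 0"
    then have "(1 / v) powr s < (1 / u) powr s" using inv assms by (intro powr_less_mono2) auto
    then show ?thesis using le(2) pos by (intro mult_less_le_imp_less) auto
  next
    assume "t > 0"
    then have "ln (1 / v) powr t < ln (1 / u) powr t"
      using ln by (intro powr_less_mono2) auto
    then show ?thesis using le(1) pos by (intro mult_le_less_imp_less) auto
  qed
  then show ?thesis using assms(1) unfolding ball_exponent_def by (simp add: mult.assoc)
qed

text \<open>Shrinking the radius by \<open>a\<close> multiplies the polynomial factor by exactly
  \<open>a powr (- s)\<close> and can only increase the logarithmic one. This trades a constant
  factor in the exponent for a constant factor in the radius.\<close>

lemma ball_exponent_scale:
  assumes "C > 0" "t \<ge> 0" "0 < a" "a \<le> 1" "0 < r" "r < 1"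
  shows "a powr (- s) * ball_exponent C s t r \<le> ball_exponent C s t (a * r)"
proof -
  have "ln (1 / r) powr t \<le> ln (1 / (a * r)) powr t"
    using assms by (intro powr_mono2) (auto simp: ln_mult ln_div)
  moreover have "(1 / (a * r)) powr s = a powr (- s) * (1 / r) powr s"
    using assms by (simp add: powr_mult powr_divide powr_minus field_simps)
  ultimately show ?thesis
    using assms unfolding ball_exponent_def by (simp add: mult_left_mono mult.assoc mult.left_commute)
qed

text \<open>In terms of \<open>u\<close> either the exponential or the power alone exceeds
  \<open>y\<close>, and \<open>u \<ge> 1\<close> keeps the other factor at least 1. It also puts
  \<open>exp (- u)\<close> to the left of \<open>exp (- 1)\<close>, as the intermediate value
  argument below requires.\<close>

lemma ball_exponent_unbounded:
  assumes "C > 0" "s \<ge> 0" "t \<ge> 0" "s > 0 \<or> t > 0"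
  shows "\<exists>u\<ge>1. y \<le> ball_exponent C s t (exp (- u))"
  using assms(4)
proof
  assume s: "s > 0"
  define u where "u = max 1 (\<bar>y\<bar> / (C * s))"
  have u: "u \<ge> 1" "\<bar>y\<bar> / (C * s) \<le> u" by (auto simp: u_def)
  have "\<bar>y\<bar> \<le> C * (s * u)" using u(2) assms s by (simp add: pos_divide_le_eq field_simps)
  also have "\<dots> \<le> C * exp (s * u)" using exp_ge_add_one_self[of "s * u"] assms by (intro mult_left_mono) linarith+
  also have "\<dots> \<le> C * exp (s * u) * u powr t"
    using assms u ge_one_powr_ge_zero[of u t] mult_left_mono[of 1 "u powr t" "C * exp (s * u)"] by simp
  finally show ?thesis using u(1) by (intro exI[of _ u]) (auto simp: ball_exponent_exp)
next
  assume t: "t > 0"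
  define u where "u = max 1 ((\<bar>y\<bar> / C) powr (1 / t))"
  have u: "u \<ge> 1" "(\<bar>y\<bar> / C) powr (1 / t) \<le> u" by (auto simp: u_def)
  have "\<bar>y\<bar> / C = ((\<bar>y\<bar> / C) powr (1 / t)) powr t" using assms t by (simp add: powr_powr)
  also have "\<dots> \<le> u powr t" using u t by (intro powr_mono2) auto
  finally have "\<bar>y\<bar> \<le> C * u powr t" using assms by (simp add: field_simps)
  also have "\<dots> \<le> C * exp (s * u) * u powr t"
    using assms u mult_left_mono[of 1 "exp (s * u)" "C * u powr t"] by (simp add: mult_ac)
  finally show ?thesis using u(1) by (intro exI[of _ u]) (auto simp: ball_exponent_exp)
qed

text \<open>\<open>the_inv_into\<close> is meaningful only for values that are attained. By
  continuity and unboundedness every value from the one at \<open>exp (- 1)\<close> upwards is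
  attained; this cut-off is harmless because the argument of interest is \<open>ln (real n)\<close>,
  which tends to infinity.\<close>

lemma ball_exponent_inv:
  assumes "C > 0" "s \<ge> 0" "t \<ge> 0" "s > 0 \<or> t > 0" "ball_exponent C s t (exp (- 1)) \<le> y"
  shows "ball_exponent_inv C s t y \<in> {0<..<1}"
    and "ball_exponent C s t (ball_exponent_inv C s t y) = y"
proof -
  have inj: "inj_on (ball_exponent C s t) {0<..<1}"
    by (rule linorder_inj_onI)
      (use ball_exponent_strict_antimono[OF assms(1-4)] in fastforce)+
  obtain u where u: "u \<ge> 1" "y \<le> ball_exponent C s t (exp (- u))"
    using ball_exponent_unbounded[OF assms(1-4)] by blast
  have nz: "z \<noteq> 0" "ln (1 / z) \<noteq> 0" if z: "z \<in> {exp (- u)..exp (- 1)}" for z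
  proof -
    have "0 < z" "z < 1"
      using z less_le_trans[OF exp_gt_zero[of "- u"]] le_less_trans[of z "exp (- 1)" 1] by auto
    then show "z \<noteq> 0" "ln (1 / z) \<noteq> 0" by simp_all
  qed
  have "continuous_on {exp (- u)..exp (- 1)} (ball_exponent C s t)"
    unfolding ball_exponent_def by (intro continuous_intros ballI) (simp_all add: nz del: ln_div)
  then obtain r where r: "exp (- u) \<le> r" "r \<le> exp (- 1)" "ball_exponent C s t r = y"
    using IVT2'[of "ball_exponent C s t" "exp (- 1)" y "exp (- u)"] u assms(5) by auto
  have "0 < exp (- u)" "exp (- 1) < (1::real)" by simp_all
  then have "r \<in> {0<..<1}" using r by (metis greaterThanLessThan_iff order_less_le_trans order_le_less_trans)
  then have im: "y \<in> ball_exponent C s t ` {0<..<1}" using r by blast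
  show "ball_exponent_inv C s t y \<in> {0<..<1}"
    unfolding ball_exponent_inv_def by (rule the_inv_into_into[OF inj im]) simp
  show "ball_exponent C s t (ball_exponent_inv C s t y) = y"
    unfolding ball_exponent_inv_def by (rule f_the_inv_into_f[OF inj im])
qed

text \<open>Since \<open>real n * \<phi> (h n)\<close> eventually exceeds \<open>C3\<close>, the
  upper small ball bound gives \<open>ball_exponent C4 t2 t3 (h n) \<le> ln (real n)\<close>.
  Passing from \<open>C4\<close> to \<open>C2\<close> costs the factor \<open>C2 / C4\<close>, which
  rescaling the radius by \<open>a\<close> pays for.\<close>

lemma bandwidth_ge_ball_exponent_inv:
  fixes \<phi> :: "real \<Rightarrow> real" and h :: "nat \<Rightarrow> real"
  assumes "C2 > 0" "C3 > 0" "C4 > 0" "t2 \<ge> 0" "t3 \<ge> 0" "t4 \<ge> 0"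
    and exponents: "t2 > 0 \<or> (t3 > 1 \<and> C2 = C4)"
    and upper: "\<forall>\<^sub>F r in at_right 0. \<phi> r \<le> C3 * r powr t4 * exp (- ball_exponent C4 t2 t3 r)"
    and h: "\<And>n. 0 < h n" "h \<longlonglongrightarrow> 0"
      "filterlim (\<lambda>n. real n * \<phi> (h n)) at_top sequentially"
  shows "\<exists>a>0. \<forall>\<^sub>F n in sequentially.
           0 < ball_exponent_inv C2 t2 t3 (ln (real n)) \<and> a * ball_exponent_inv C2 t2 t3 (ln (real n)) \<le> h n"
proof -
  \<comment> \<open>Chosen so that \<open>C2 / C4 \<le> a powr (- t2)\<close>. For
    \<open>t2 = 0\<close> rescaling gains nothing in the polynomial factor, but then
    \<open>C2 = C4\<close> and \<open>a = 1\<close> suffices.\<close>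
  define a where "a = (if t2 > 0 then min 1 ((C4 / C2) powr (1 / t2)) else 1)"
  have a: "0 < a" "a \<le> 1" using assms(1,3) by (auto simp: a_def)
  have aC: "C2 / C4 \<le> a powr (- t2)"
  proof (cases "t2 > 0")
    case True
    have "a powr t2 \<le> ((C4 / C2) powr (1 / t2)) powr t2"
      using True a by (intro powr_mono2) (auto simp: a_def)
    also have "\<dots> = C4 / C2" using True assms by (simp add: powr_powr)
    finally show ?thesis using assms a by (simp add: powr_minus field_simps)
  next
    case False
    then show ?thesis using exponents assms by (auto simp: a_def)
  qed
  have lim: "filterlim h (at_right 0) sequentially"
    using h(2) less_imp_neq[OF h(1)] by (auto simp: filterlim_at h(1) intro!: always_eventually)
  have ln_top: "filterlim (\<lambda>n. ln (real n)) at_top sequentially"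
    by (intro filterlim_compose[OF ln_at_top] filterlim_real_sequentially)
  have st: "t2 > 0 \<or> t3 > 0" using exponents by auto
  have "\<forall>\<^sub>F n in sequentially. h n < 1" using order_tendstoD(2)[OF h(2)] by simp
  \<comment> \<open>The level \<open>C3\<close> is taken because it cancels the constant in the
    upper bound for \<open>\<phi>\<close>.\<close>
  moreover have "\<forall>\<^sub>F n in sequentially. C3 \<le> real n * \<phi> (h n)"
    using h(3) by (simp add: filterlim_at_top)
  moreover have "\<forall>\<^sub>F n in sequentially.
      \<phi> (h n) \<le> C3 * h n powr t4 * exp (- ball_exponent C4 t2 t3 (h n))"
    using filterlim_iff[THEN iffD1, OF lim] upper by blast
  moreover have "\<forall>\<^sub>F n in sequentially. ball_exponent C2 t2 t3 (exp (- 1)) \<le> ln (real n)"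
    using ln_top by (simp add: filterlim_at_top)
  moreover have "\<forall>\<^sub>F n in sequentially. n > (0::nat)" by (rule eventually_gt_at_top)
  ultimately have "\<forall>\<^sub>F n in sequentially.
    0 < ball_exponent_inv C2 t2 t3 (ln (real n)) \<and> a * ball_exponent_inv C2 t2 t3 (ln (real n)) \<le> h n"
  proof eventually_elim
    case (elim n)
    define r where "r = ball_exponent_inv C2 t2 t3 (ln (real n))"
    have r: "0 < r" "r < 1" "ball_exponent C2 t2 t3 r = ln (real n)"
      using ball_exponent_inv[OF assms(1,4,5) st elim(4)] by (auto simp: r_def)
    have "h n powr t4 \<le> 1" using h(1)[of n] elim(1) \<open>t4 \<ge> 0\<close> powr_mono2[of t4 "h n" 1] by simp
    then have "C3 * h n powr t4 * exp (- ball_exponent C4 t2 t3 (h n))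
        \<le> C3 * 1 * exp (- ball_exponent C4 t2 t3 (h n))"
      using assms by (intro mult_right_mono mult_left_mono) auto
    then have "\<phi> (h n) \<le> C3 * exp (- ball_exponent C4 t2 t3 (h n))"
      using elim(3) by simp
    then have "C3 \<le> real n * (C3 * exp (- ball_exponent C4 t2 t3 (h n)))"
      using elim(2) mult_left_mono[of "\<phi> (h n)" _ "real n"] by fastforce
    then have "exp (ball_exponent C4 t2 t3 (h n)) \<le> real n"
      using assms by (simp add: exp_minus field_simps)
    then have le: "ball_exponent C4 t2 t3 (h n) \<le> ln (real n)"
      using elim(5) by (metis exp_gt_zero ln_exp ln_le_cancel_iff of_nat_0_less_iff)
    have rel: "ball_exponent C2 t2 t3 (h n) = C2 / C4 * ball_exponent C4 t2 t3 (h n)"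
      using assms by (simp add: ball_exponent_def)
    have "a * r \<le> h n"
    proof (rule ccontr)
      assume "\<not> a * r \<le> h n"
      moreover have "a * r < 1" using a r by (metis mult_left_le_one_le order_le_less_trans less_imp_le)
      ultimately have "ball_exponent C2 t2 t3 (a * r) < ball_exponent C2 t2 t3 (h n)"
        using ball_exponent_strict_antimono[OF assms(1,4,5) st h(1)[of n]] by simp
      also have "\<dots> \<le> C2 / C4 * ln (real n)"
        unfolding rel using le assms by (intro mult_left_mono) auto
      also have "\<dots> \<le> a powr (- t2) * ln (real n)"
        using aC elim(5) by (intro mult_right_mono) auto
      also have "\<dots> \<le> ball_exponent C2 t2 t3 (a * r)"
        using ball_exponent_scale[OF assms(1,5) a r(1,2), of t2] r(3) by simp
      finally show False by simp
    qed
    then show ?case using r by (simp add: r_def)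
  qed
  then show ?thesis using a by blast
qed

section \<open>Sums of independent random elements\<close>

text \<open>The modulus on the left ignores shifts of \<open>U\<close>, so the bound serves for sums
  whose mean is not controlled. In the application \<open>t\<close> is the reciprocal of the scale
  of \<open>U\<close>, and \<open>t * a\<close> is a fixed constant.\<close>

lemma (in prob_space) prob_abs_ge_char:
  assumes U[measurable]: "U \<in> borel_measurable M" and a: "0 \<le> a"
  shows "(1 - cmod (char (distr M borel U) t) - (t * a)\<^sup>2 / 2) / 2 \<le> prob {\<omega>\<in>space M. a \<le> \<bar>U \<omega>\<bar>}"
proof -
  define E where "E = {\<omega>\<in>space M. a \<le> \<bar>U \<omega>\<bar>}"
  have E[measurable]: "E \<in> events" unfolding E_def by measurable
  have cos_lower: "1 - y\<^sup>2 / 2 \<le> cos y" for y :: real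
  proof -
    have "(sin (y / 2))\<^sup>2 \<le> (y / 2)\<^sup>2"
      using abs_sin_x_le_abs_x[of "y / 2"] by (simp only: abs_le_square_iff)
    then show ?thesis using cos_double_sin[of "y / 2"] by (simp add: power_divide)
  qed
  \<comment> \<open>If \<open>U\<close> were mostly in \<open>(-a, a)\<close>, then \<open>cos (t U)\<close> would be mostly close to 1.\<close>
  have pw: "1 - (t * a)\<^sup>2 / 2 - 2 * indicator E \<omega> \<le> cos (t * U \<omega>)" if "\<omega> \<in> space M" for \<omega>
  proof (cases "\<omega> \<in> E")
    case True
    moreover have "- 1 \<le> cos (t * U \<omega>)" "0 \<le> (t * a)\<^sup>2" by simp_all
    ultimately show ?thesis by (simp only: indicator_simps)
  next
    case False
    then have "\<bar>U \<omega>\<bar> \<le> \<bar>a\<bar>" using that by (auto simp: E_def)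
    then have "\<bar>t * U \<omega>\<bar> \<le> \<bar>t * a\<bar>" by (simp add: abs_mult mult_left_mono)
    then have "(t * U \<omega>)\<^sup>2 \<le> (t * a)\<^sup>2" by (simp add: abs_le_square_iff)
    then show ?thesis using cos_lower[of "t * U \<omega>"] False by simp
  qed
  have int_exp: "integrable M (\<lambda>\<omega>. iexp (t * U \<omega>))"
    by (intro integrable_const_bound[of _ 1]) auto
  have int_E: "integrable M (indicat_real E)"
    by (intro integrable_const_bound[of _ 1]) (auto simp: indicator_def)
  have "1 - (t * a)\<^sup>2 / 2 - 2 * prob E = expectation (\<lambda>\<omega>. 1 - (t * a)\<^sup>2 / 2 - 2 * indicator E \<omega>)"
    by (subst Bochner_Integration.integral_diff) (use int_E in \<open>auto simp: prob_space\<close>)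
  also have "\<dots> \<le> expectation (\<lambda>\<omega>. cos (t * U \<omega>))"
  proof (intro integral_mono pw)
    show "integrable M (\<lambda>\<omega>. cos (t * U \<omega>))"
      by (intro integrable_const_bound[of _ 1]) auto
  qed (use int_E in auto)
  also have "\<dots> = expectation (\<lambda>\<omega>. Re (iexp (t * U \<omega>)))"
    by (simp add: Re_exp)
  also have "\<dots> = Re (char (distr M borel U) t)"
    using int_exp by (simp add: char_def integral_distr)
  also have "\<dots> \<le> cmod (char (distr M borel U) t)" by (rule complex_Re_le_cmod)
  finally show ?thesis by (simp add: E_def)
qed

text \<open>With moments of order \<open>p\<close> between 2 and 3 only, the remainder
  \<open>min (6 * y ^ 2) (t * y ^ 3)\<close> of the quadratic expansion is interpolated by
  \<open>6 * t powr (p - 2) * y powr p\<close>.\<close>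

lemma (in prob_space) cmod_char_le:
  assumes V[measurable]: "V \<in> borel_measurable M" and V2: "integrable M (\<lambda>\<omega>. (V \<omega>)\<^sup>2)"
    and p: "2 < p" "p \<le> 3"
    and Vp: "integrable M (\<lambda>\<omega>. \<bar>V \<omega> - expectation V\<bar> powr p)"
    and t: "t > 0" "t\<^sup>2 * variance V \<le> 2"
  shows "cmod (char (distr M borel V) t)
    \<le> 1 - t\<^sup>2 * variance V / 2 + t powr p * expectation (\<lambda>\<omega>. \<bar>V \<omega> - expectation V\<bar> powr p)"
proof -
  define \<mu> where "\<mu> = expectation V"
  define U where "U = (\<lambda>\<omega>. V \<omega> - \<mu>)"
  have [measurable]: "U \<in> borel_measurable M" unfolding U_def by measurable
  have V1: "integrable M V" using V V2 by (rule square_integrable_imp_integrable)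
  have U1: "integrable M U" using V1 by (simp add: U_def)
  have EU: "expectation U = 0" using V1 by (simp add: U_def \<mu>_def prob_space)
  have U2: "integrable M (\<lambda>\<omega>. (U \<omega>)\<^sup>2)"
    unfolding U_def power2_diff using V1 V2 by simp
  have varU: "variance U = variance V" by (simp add: EU) (simp add: U_def \<mu>_def)
  \<comment> \<open>The mean contributes a factor of modulus 1, so it suffices to expand the centred
    variable.\<close>
  have "char (distr M borel V) t = iexp (t * \<mu>) * char (distr M borel U) t"
  proof -
    have "char (distr M borel V) t = (CLINT \<omega>|M. iexp (t * \<mu>) * iexp (t * U \<omega>))"
      by (simp add: char_def integral_distr U_def flip: exp_add) (simp add: algebra_simps)
    then show ?thesis by (simp add: char_def integral_distr)
  qed
  then have "cmod (char (distr M borel V) t) = cmod (char (distr M borel U) t)"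
    by (simp add: norm_mult)
  also have "\<dots> \<le> cmod (complex_of_real (1 - t\<^sup>2 * variance U / 2))
      + cmod (char (distr M borel U) t - complex_of_real (1 - t\<^sup>2 * variance U / 2))"
    by (metis norm_triangle_sub)
  \<comment> \<open>Here \<open>t\<^sup>2 * variance V \<le> 2\<close> makes the quadratic
    approximation nonnegative, hence equal to its modulus.\<close>
  also have "cmod (complex_of_real (1 - t\<^sup>2 * variance U / 2)) = 1 - t\<^sup>2 * variance V / 2"
    unfolding norm_of_real using t(2) varU by simp
  also have "cmod (char (distr M borel U) t - complex_of_real (1 - t\<^sup>2 * variance U / 2))
      \<le> t\<^sup>2 / 6 * expectation (\<lambda>\<omega>. min (6 * (U \<omega>)\<^sup>2) (\<bar>t\<bar> * \<bar>U \<omega>\<bar> ^ 3))"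
    using char_approx3'[of U "variance U" "distr M borel U" t] U1 U2 EU by simp
  also have "expectation (\<lambda>\<omega>. min (6 * (U \<omega>)\<^sup>2) (\<bar>t\<bar> * \<bar>U \<omega>\<bar> ^ 3))
      \<le> expectation (\<lambda>\<omega>. 6 * t powr (p - 2) * \<bar>U \<omega>\<bar> powr p)"
  proof (rule integral_mono)
    show "integrable M (\<lambda>\<omega>. min (6 * (U \<omega>)\<^sup>2) (\<bar>t\<bar> * \<bar>U \<omega>\<bar> ^ 3))"
      by (rule Bochner_Integration.integrable_bound[where f = "\<lambda>\<omega>. 6 * (U \<omega>)\<^sup>2"]) (use U2 in auto)
    show "integrable M (\<lambda>\<omega>. 6 * t powr (p - 2) * \<bar>U \<omega>\<bar> powr p)"
      using Vp by (simp add: U_def \<mu>_def)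
    fix \<omega>
    define y where "y = \<bar>U \<omega>\<bar>"
    have y2: "(U \<omega>)\<^sup>2 = y\<^sup>2" by (simp add: y_def)
    show "min (6 * (U \<omega>)\<^sup>2) (\<bar>t\<bar> * \<bar>U \<omega>\<bar> ^ 3) \<le> 6 * t powr (p - 2) * \<bar>U \<omega>\<bar> powr p"
    proof (cases "y = 0")
      case True
      then show ?thesis using t by (simp add: y_def)
    next
      case False
      then have y: "y > 0" by (simp add: y_def)
      \<comment> \<open>In this form \<open>(t * y) powr (p - 2)\<close> only has to be compared
        with \<open>t * y\<close> if \<open>t * y \<le> 1\<close>, where
        \<open>p - 2 \<le> 1\<close> helps, and with 1 otherwise.\<close>
      have eq: "t powr (p - 2) * y powr p = (t * y) powr (p - 2) * y\<^sup>2"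
        using y t by (simp add: powr_mult powr_diff powr_numeral)
      show ?thesis
      proof (cases "t * y \<le> 1")
        case True
        have "t * y = (t * y) powr 1" using t y by simp
        also have "\<dots> \<le> (t * y) powr (p - 2)" using True t y p by (intro powr_mono') auto
        finally have "t * y * y\<^sup>2 \<le> (t * y) powr (p - 2) * y\<^sup>2" by (rule mult_right_mono) simp
        moreover have "0 \<le> (t * y) powr (p - 2) * y\<^sup>2" by simp
        moreover have "\<bar>t\<bar> * y ^ 3 = t * y * y\<^sup>2" using t by (simp add: power2_eq_square power3_eq_cube)
        ultimately show ?thesis using eq unfolding y2 y_def[symmetric] by linarith
      next
        case False
        then have "1 \<le> (t * y) powr (p - 2)" using p by (intro ge_one_powr_ge_zero) auto
        then have "1 * y\<^sup>2 \<le> (t * y) powr (p - 2) * y\<^sup>2" by (rule mult_right_mono) simp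
        then show ?thesis using eq unfolding y2 y_def[symmetric] by linarith
      qed
    qed
  qed
  finally have "cmod (char (distr M borel V) t) \<le> 1 - t\<^sup>2 * variance V / 2
      + t\<^sup>2 / 6 * expectation (\<lambda>\<omega>. 6 * t powr (p - 2) * \<bar>U \<omega>\<bar> powr p)"
    by (simp add: mult_left_mono)
  also have "t\<^sup>2 / 6 * expectation (\<lambda>\<omega>. 6 * t powr (p - 2) * \<bar>U \<omega>\<bar> powr p)
      = t powr p * expectation (\<lambda>\<omega>. \<bar>U \<omega>\<bar> powr p)"
    using t by (simp add: powr_diff powr_numeral)
  finally show ?thesis by (simp add: U_def \<mu>_def)
qed

text \<open>Here \<open>\<phi>\<close> is the common order of the variance and the central
  \<open>p\<close>-th moment. At the frequency matching the standard deviation of the sum each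
  factor of the characteristic function is at most \<open>1 - \<sigma> / (4 * n)\<close>, and
  \<open>n\<close> factors give at most \<open>exp (- \<sigma> / 4)\<close>.\<close>

lemma (in prob_space) prob_abs_sum_ge:
  fixes n :: nat and \<phi> C :: real
  assumes indep: "indep_vars (\<lambda>_. borel) V {1..n}"
    and ident: "\<And>i. i \<in> {1..n} \<Longrightarrow> distr M borel (V i) = distr M borel V0"
    and V0: "V0 \<in> borel_measurable M" "integrable M (\<lambda>\<omega>. (V0 \<omega>)\<^sup>2)"
    and p: "2 < p" "p \<le> 3" "integrable M (\<lambda>\<omega>. \<bar>V0 \<omega> - expectation V0\<bar> powr p)"
    and pos: "n \<ge> 1" "\<phi> > 0"
    and var: "\<sigma> * \<phi> \<le> variance V0" "variance V0 \<le> C * \<phi>"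
    and mom: "expectation (\<lambda>\<omega>. \<bar>V0 \<omega> - expectation V0\<bar> powr p) \<le> C * \<phi>"
    and large: "C \<le> 2 * n" "C * (n * \<phi>) powr (1 - p / 2) \<le> \<sigma> / 4"
    and c: "0 \<le> c" "c\<^sup>2 \<le> 1 - exp (- \<sigma> / 4)"
  shows "(1 - exp (- \<sigma> / 4)) / 4 \<le> prob {\<omega>\<in>space M. c * sqrt (n * \<phi>) \<le> \<bar>\<Sum>i=1..n. V i \<omega>\<bar>}"
proof -
  define S where "S = n * \<phi>"
  \<comment> \<open>At this frequency the quadratic term of each factor is at least
    \<open>\<sigma> / (2 * n)\<close>, while the remainder is at most
    \<open>C * S powr (1 - p / 2) / n\<close>, which is small for large \<open>S\<close> since
    \<open>p > 2\<close>.\<close>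
  define t where "t = 1 / sqrt S"
  have S: "S > 0" using pos by (simp add: S_def)
  have t: "t > 0" "t\<^sup>2 = 1 / S" using S by (simp_all add: t_def power_divide)
  have \<phi>: "\<phi> = S / n" using pos by (simp add: S_def)
  have tp: "t powr p = S powr (- p / 2)"
    using S by (simp add: t_def powr_divide powr_half_sqrt[symmetric] powr_powr powr_minus_divide)
  define \<gamma> where "\<gamma> = cmod (char (distr M borel V0) t)"
  have "t\<^sup>2 * variance V0 \<le> t\<^sup>2 * (C * \<phi>)" using var by (intro mult_left_mono) auto
  also have "\<dots> = C / n" using S pos by (simp add: t \<phi>)
  also have "\<dots> \<le> 2" using large(1) pos by (simp add: pos_divide_le_eq)
  finally have "\<gamma> \<le> 1 - t\<^sup>2 * variance V0 / 2
      + t powr p * expectation (\<lambda>\<omega>. \<bar>V0 \<omega> - expectation V0\<bar> powr p)"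
    unfolding \<gamma>_def by (intro cmod_char_le V0 p t)
  also have "\<dots> \<le> 1 - t\<^sup>2 * (\<sigma> * \<phi>) / 2 + t powr p * (C * \<phi>)"
    using var mom by (intro add_mono diff_mono divide_right_mono mult_left_mono) auto
  also have "t\<^sup>2 * (\<sigma> * \<phi>) = \<sigma> / n" using S pos by (simp add: t \<phi>)
  also have "t powr p * (C * \<phi>) = C * S powr (1 - p / 2) / n"
  proof -
    have "S powr (1 - p / 2) = S * S powr (- p / 2)" using S by (simp add: powr_diff powr_minus_divide)
    then show ?thesis by (simp add: tp \<phi>)
  qed
  also have "\<dots> \<le> \<sigma> / 4 / n" using large(2) pos by (intro divide_right_mono) (auto simp: S_def)
  finally have "\<gamma> \<le> 1 + (- \<sigma> / 4) / n" by (simp add: field_simps)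
  also have "\<dots> \<le> exp ((- \<sigma> / 4) / n)" by (rule exp_ge_add_one_self)
  finally have "\<gamma> ^ n \<le> exp ((- \<sigma> / 4) / n) ^ n" by (intro power_mono) (auto simp: \<gamma>_def)
  also have "\<dots> = exp (- \<sigma> / 4)"
    using pos by (simp flip: exp_of_nat_mult)
  finally have \<gamma>n: "\<gamma> ^ n \<le> exp (- \<sigma> / 4)" .
  have Vm: "V i \<in> borel_measurable M" if "i \<in> {1..n}" for i
    using indep that unfolding indep_vars_def by auto
  have "cmod (char (distr M borel (\<lambda>\<omega>. \<Sum>i=1..n. V i \<omega>)) t) = \<gamma> ^ n"
    unfolding char_distr_sum[OF indep] prod_norm[symmetric] by (simp add: ident \<gamma>_def)
  then have "(1 - \<gamma> ^ n - (t * (c * sqrt S))\<^sup>2 / 2) / 2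
      \<le> prob {\<omega>\<in>space M. c * sqrt S \<le> \<bar>\<Sum>i=1..n. V i \<omega>\<bar>}"
    using prob_abs_ge_char[of "\<lambda>\<omega>. \<Sum>i=1..n. V i \<omega>" "c * sqrt S" t] Vm c S by simp
  moreover have "t * (c * sqrt S) = c" using S by (simp add: t_def)
  ultimately have "(1 - \<gamma> ^ n - c\<^sup>2 / 2) / 2 \<le> prob {\<omega>\<in>space M. c * sqrt S \<le> \<bar>\<Sum>i=1..n. V i \<omega>\<bar>}"
    by simp
  \<comment> \<open>Of the gap \<open>1 - exp (- \<sigma> / 4)\<close> the term
    \<open>c\<^sup>2 / 2\<close> uses up at most half; the other factor 1/2 comes from
    \<open>prob_abs_ge_char\<close>.\<close>
  moreover have "(1 - exp (- \<sigma> / 4)) / 4 \<le> (1 - \<gamma> ^ n - c\<^sup>2 / 2) / 2"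
    using \<gamma>n c by simp
  ultimately show ?thesis unfolding S_def by linarith
qed

lemma powr_add_le_2_powr:
  fixes a b p :: real
  assumes "0 \<le> a" "0 \<le> b" "0 \<le> p"
  shows "(a + b) powr p \<le> 2 powr p * (a powr p + b powr p)"
proof -
  have "(a + b) powr p \<le> (2 * max a b) powr p" using assms by (intro powr_mono2) auto
  also have "\<dots> = 2 powr p * max a b powr p" using assms by (simp add: powr_mult)
  also have "\<dots> \<le> 2 powr p * (a powr p + b powr p)"
    by (intro mult_left_mono) (auto simp: max_def)
  finally show ?thesis .
qed

text \<open>The constants are obtained before \<open>n\<close>, \<open>\<phi>\<close> and the
  variables, because in the application the law of the summands varies with the bandwidth. Raw
  moments are bounded here; centring preserves their order, since \<open>\<phi> \<le> 1\<close>
  gives \<open>(J * \<phi>) powr p \<le> J powr p * \<phi>\<close>.\<close>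

lemma (in prob_space) prob_abs_sum_ge_uniform:
  assumes "0 < \<sigma>" "0 \<le> J" and p: "2 < p" "p \<le> 3"
  obtains c q S0 :: real where "0 < c" "0 < q"
    "\<And>(n::nat) (\<phi>::real) (V :: nat \<Rightarrow> 'a \<Rightarrow> real) V0. indep_vars (\<lambda>_. borel) V {1..n} \<Longrightarrow>
      (\<And>i. i \<in> {1..n} \<Longrightarrow> distr M borel (V i) = distr M borel V0) \<Longrightarrow>
      V0 \<in> borel_measurable M \<Longrightarrow> integrable M (\<lambda>\<omega>. (V0 \<omega>)\<^sup>2) \<Longrightarrow>
      integrable M (\<lambda>\<omega>. \<bar>V0 \<omega>\<bar> powr p) \<Longrightarrow> 0 < \<phi> \<Longrightarrow> \<phi> \<le> 1 \<Longrightarrow> S0 \<le> n * \<phi> \<Longrightarrow>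
      expectation (\<lambda>\<omega>. \<bar>V0 \<omega>\<bar>) \<le> J * \<phi> \<Longrightarrow> expectation (\<lambda>\<omega>. (V0 \<omega>)\<^sup>2) \<le> J * \<phi> \<Longrightarrow>
      expectation (\<lambda>\<omega>. \<bar>V0 \<omega>\<bar> powr p) \<le> J * \<phi> \<Longrightarrow> \<sigma> * \<phi> \<le> variance V0 \<Longrightarrow>
      q \<le> prob {\<omega>\<in>space M. c * sqrt (n * \<phi>) \<le> \<bar>\<Sum>i=1..n. V i \<omega>\<bar>}"
proof -
  \<comment> \<open>\<open>J\<close> bounds the variance through the second moment; the other term
    bounds the centred \<open>p\<close>-th moment through \<open>powr_add_le_2_powr\<close>.\<close>
  define C where "C = J + 2 powr p * (J + J powr p)"
  have C: "0 \<le> C" "J \<le> C" using assms by (auto simp: C_def)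
  have e: "0 < 1 - exp (- \<sigma> / 4)" using assms by simp
  define c where "c = sqrt (1 - exp (- \<sigma> / 4))"
  have c: "0 < c" "c\<^sup>2 \<le> 1 - exp (- \<sigma> / 4)" using e by (simp_all add: c_def)
  have "((\<lambda>s. C * s powr (1 - p / 2)) \<longlongrightarrow> C * 0) at_top"
    using p by (intro tendsto_mult tendsto_const tendsto_neg_powr filterlim_ident) auto
  then have "\<forall>\<^sub>F s in at_top. C * s powr (1 - p / 2) < \<sigma> / 4"
    using assms(1) by (auto dest: order_tendstoD(2)[of _ _ _ "\<sigma> / 4"])
  then obtain S1 where S1: "\<And>s. S1 \<le> s \<Longrightarrow> C * s powr (1 - p / 2) < \<sigma> / 4"
    by (auto simp: eventually_at_top_linorder)
  show thesis
  \<comment> \<open>As \<open>\<phi> \<le> 1\<close>, the product \<open>n * \<phi>\<close> is at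
    most \<open>n\<close>, so this threshold also yields \<open>1 \<le> n\<close> and
    \<open>C \<le> 2 * n\<close>.\<close>
  proof (rule that[of c "(1 - exp (- \<sigma> / 4)) / 4" "max S1 (max 1 C)"])
    show "0 < c" "0 < (1 - exp (- \<sigma> / 4)) / 4" using c e by auto
    fix n :: nat and \<phi> :: real and V :: "nat \<Rightarrow> 'a \<Rightarrow> real" and V0
    assume indep: "indep_vars (\<lambda>_. borel) V {1..n}"
      and ident: "\<And>i. i \<in> {1..n} \<Longrightarrow> distr M borel (V i) = distr M borel V0"
      and V0[measurable]: "V0 \<in> borel_measurable M" and V2: "integrable M (\<lambda>\<omega>. (V0 \<omega>)\<^sup>2)"
      and Vp: "integrable M (\<lambda>\<omega>. \<bar>V0 \<omega>\<bar> powr p)" and \<phi>: "0 < \<phi>" "\<phi> \<le> 1"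
      and S: "max S1 (max 1 C) \<le> n * \<phi>"
      and m1: "expectation (\<lambda>\<omega>. \<bar>V0 \<omega>\<bar>) \<le> J * \<phi>" and m2: "expectation (\<lambda>\<omega>. (V0 \<omega>)\<^sup>2) \<le> J * \<phi>"
      and mp: "expectation (\<lambda>\<omega>. \<bar>V0 \<omega>\<bar> powr p) \<le> J * \<phi>" and var: "\<sigma> * \<phi> \<le> variance V0"
    define \<mu> where "\<mu> = expectation V0"
    have V1: "integrable M V0" using V0 V2 by (rule square_integrable_imp_integrable)
    have "\<bar>\<mu>\<bar> \<le> J * \<phi>"
      using m1 integral_abs_bound[of M V0] unfolding \<mu>_def by linarith
    then have "\<bar>\<mu>\<bar> powr p \<le> (J * \<phi>) powr p" using p by (intro powr_mono2) auto
    also have "\<dots> = J powr p * \<phi> powr p" using assms \<phi> by (simp add: powr_mult)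
    also have "\<phi> powr p \<le> \<phi>" using \<phi> p powr_mono'[of 1 p \<phi>] by simp
    finally have \<mu>p: "\<bar>\<mu>\<bar> powr p \<le> J powr p * \<phi>" by (simp add: mult_left_mono)
    have pw: "\<bar>V0 \<omega> - \<mu>\<bar> powr p \<le> 2 powr p * (\<bar>V0 \<omega>\<bar> powr p + J powr p * \<phi>)" for \<omega>
    proof -
      have "\<bar>V0 \<omega> - \<mu>\<bar> powr p \<le> (\<bar>V0 \<omega>\<bar> + \<bar>\<mu>\<bar>) powr p" using p by (intro powr_mono2) auto
      also have "\<dots> \<le> 2 powr p * (\<bar>V0 \<omega>\<bar> powr p + \<bar>\<mu>\<bar> powr p)"
        using p by (intro powr_add_le_2_powr) auto
      also have "\<dots> \<le> 2 powr p * (\<bar>V0 \<omega>\<bar> powr p + J powr p * \<phi>)" using \<mu>p by simp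
      finally show ?thesis .
    qed
    have ci: "integrable M (\<lambda>\<omega>. \<bar>V0 \<omega> - \<mu>\<bar> powr p)"
      by (rule Bochner_Integration.integrable_bound
          [where f = "\<lambda>\<omega>. 2 powr p * (\<bar>V0 \<omega>\<bar> powr p + J powr p * \<phi>)"])
        (use Vp pw in \<open>auto intro: order_trans[OF pw] abs_ge_self\<close>)
    have "expectation (\<lambda>\<omega>. \<bar>V0 \<omega> - \<mu>\<bar> powr p)
        \<le> expectation (\<lambda>\<omega>. 2 powr p * (\<bar>V0 \<omega>\<bar> powr p + J powr p * \<phi>))"
      using Vp ci pw by (intro integral_mono) auto
    also have "\<dots> = 2 powr p * (expectation (\<lambda>\<omega>. \<bar>V0 \<omega>\<bar> powr p) + J powr p * \<phi>)"
      using Vp by (simp add: prob_space)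
    also have "\<dots> \<le> 2 powr p * (J * \<phi> + J powr p * \<phi>)" using mp by simp
    also have "\<dots> \<le> C * \<phi>" using assms \<phi> by (simp add: C_def algebra_simps)
    finally have mom: "expectation (\<lambda>\<omega>. \<bar>V0 \<omega> - \<mu>\<bar> powr p) \<le> C * \<phi>" .
    have "variance V0 \<le> expectation (\<lambda>\<omega>. (V0 \<omega>)\<^sup>2)"
      using variance_eq[OF V1 V2] by simp
    also have "\<dots> \<le> C * \<phi>" using m2 mult_right_mono[OF C(2), of \<phi>] \<phi> by linarith
    finally have var2: "variance V0 \<le> C * \<phi>" .
    have n: "max S1 (max 1 C) \<le> real n"
      using S \<phi> mult_left_mono[of \<phi> 1 "real n"] by linarith
    show "(1 - exp (- \<sigma> / 4)) / 4 \<le> prob {\<omega>\<in>space M. c * sqrt (n * \<phi>) \<le> \<bar>\<Sum>i=1..n. V i \<omega>\<bar>}"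
      by (rule prob_abs_sum_ge[OF indep ident V0 V2 p _ _ \<phi>(1) var var2])
        (use ci mom n S S1[of "n * \<phi>"] c C in \<open>auto simp: \<mu>_def\<close>)
  qed
qed

text \<open>Chebyshev's inequality, where the type 2 inequality replaces the additivity of
  variances. Again \<open>A\<close> is chosen before \<open>n\<close> and the law of the
  summands.\<close>

lemma (in prob_space) prob_norm_centred_sum_ge:
  assumes "type_2 TYPE('b::{banach, second_countable_topology})" "0 \<le> J"
  obtains A :: real where "0 < A"
    "\<And>(n::nat) (\<phi>::real) (W :: nat \<Rightarrow> 'a \<Rightarrow> 'b) W0. indep_vars (\<lambda>_. borel) W {1..n} \<Longrightarrow>
      (\<And>i. i \<in> {1..n} \<Longrightarrow> distr M borel (W i) = distr M borel W0) \<Longrightarrow>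
      W0 \<in> borel_measurable M \<Longrightarrow> integrable M (\<lambda>\<omega>. (norm (W0 \<omega>))\<^sup>2) \<Longrightarrow>
      0 < \<phi> \<Longrightarrow> \<phi> \<le> 1 \<Longrightarrow> 1 \<le> n \<Longrightarrow>
      expectation (\<lambda>\<omega>. norm (W0 \<omega>)) \<le> J * \<phi> \<Longrightarrow> expectation (\<lambda>\<omega>. (norm (W0 \<omega>))\<^sup>2) \<le> J * \<phi> \<Longrightarrow>
      prob {\<omega>\<in>space M. A * sqrt (n * \<phi>) \<le> norm ((\<Sum>i=1..n. W i \<omega>) - real n *\<^sub>R expectation W0)} \<le> 1 / 2"
proof -
  obtain c0 :: real where c0: "c0 > 0" and bd:
    "\<And>n (M :: 'a measure) (Z :: nat \<Rightarrow> 'a \<Rightarrow> 'b).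
       prob_space M \<Longrightarrow> prob_space.indep_vars M (\<lambda>_. borel) Z {1..n} \<Longrightarrow>
       (\<And>i. i \<in> {1..n} \<Longrightarrow> integrable M (\<lambda>\<omega>. (norm (Z i \<omega>))\<^sup>2)) \<Longrightarrow>
       (\<And>i. i \<in> {1..n} \<Longrightarrow> (\<integral>\<omega>. Z i \<omega> \<partial>M) = 0) \<Longrightarrow>
       (\<integral>\<omega>. (norm (\<Sum>i=1..n. Z i \<omega>))\<^sup>2 \<partial>M) \<le> c0 * (\<Sum>i=1..n. \<integral>\<omega>. (norm (Z i \<omega>))\<^sup>2 \<partial>M)"
    using type_2_bound[OF assms(1)] by blast
  \<comment> \<open>Constant for the centred second moment: the mean adds at most
    \<open>2 * J\<^sup>2 * \<phi>\<close>, because \<open>\<phi> \<le> 1\<close>.\<close>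
  define J2 where "J2 = 2 * J + 2 * J\<^sup>2"
  have J2: "0 \<le> J2" using assms by (simp add: J2_def)
  \<comment> \<open>This makes the Chebyshev bound equal to \<open>J2 / (2 * (J2 + 1))\<close>,
    below 1/2; the added 1 keeps \<open>A\<close> positive even if \<open>J2 = 0\<close>.\<close>
  define A where "A = sqrt (2 * c0 * (J2 + 1))"
  have A: "0 < A" "A\<^sup>2 = 2 * c0 * (J2 + 1)" using c0 J2 by (simp_all add: A_def)
  show thesis
  proof (rule that[OF A(1)])
    fix n :: nat and \<phi> :: real and W :: "nat \<Rightarrow> 'a \<Rightarrow> 'b" and W0
    assume indep: "indep_vars (\<lambda>_. borel) W {1..n}"
      and ident: "\<And>i. i \<in> {1..n} \<Longrightarrow> distr M borel (W i) = distr M borel W0"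
      and W0[measurable]: "W0 \<in> borel_measurable M" and W2: "integrable M (\<lambda>\<omega>. (norm (W0 \<omega>))\<^sup>2)"
      and \<phi>: "0 < \<phi>" "\<phi> \<le> 1" and n: "1 \<le> n"
      and m1: "expectation (\<lambda>\<omega>. norm (W0 \<omega>)) \<le> J * \<phi>"
      and m2: "expectation (\<lambda>\<omega>. (norm (W0 \<omega>))\<^sup>2) \<le> J * \<phi>"
    define \<mu> where "\<mu> = expectation W0"
    define Z where "Z = (\<lambda>i \<omega>. W i \<omega> - \<mu>)"
    have Wm[measurable]: "W i \<in> borel_measurable M" if "i \<in> {1..n}" for i
      using indep that unfolding indep_vars_def by auto
    have W1n: "integrable M (\<lambda>\<omega>. norm (W0 \<omega>))"
      by (rule square_integrable_imp_integrable[OF _ W2]) measurable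
    then have W1: "integrable M W0" by (simp add: integrable_norm_iff)
    have indepZ: "indep_vars (\<lambda>_. borel) Z {1..n}"
      unfolding Z_def by (rule indep_vars_compose2[OF indep]) measurable
    have tr: "integrable M (\<lambda>\<omega>. g (W i \<omega>)) = integrable M (\<lambda>\<omega>. g (W0 \<omega>))"
      "(\<integral>\<omega>. g (W i \<omega>) \<partial>M) = (\<integral>\<omega>. g (W0 \<omega>) \<partial>M)"
      if i: "i \<in> {1..n}" and g: "g \<in> borel_measurable borel" for i and g :: "'b \<Rightarrow> 'z::{banach, second_countable_topology}"
      using integrable_distr_eq[OF Wm[OF i] g] integrable_distr_eq[OF W0 g]
        integral_distr[OF Wm[OF i] g] integral_distr[OF W0 g] ident[OF i] by simp_all
    have pw: "(norm (W0 \<omega> - \<mu>))\<^sup>2 \<le> 2 * (norm (W0 \<omega>))\<^sup>2 + 2 * (norm \<mu>)\<^sup>2" for \<omega>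
    proof -
      have "(norm (W0 \<omega> - \<mu>))\<^sup>2 \<le> (norm (W0 \<omega>) + norm \<mu>)\<^sup>2"
        by (intro power_mono norm_triangle_ineq4) simp
      also have "\<dots> \<le> 2 * (norm (W0 \<omega>))\<^sup>2 + 2 * (norm \<mu>)\<^sup>2"
        using sum_squares_bound[of "norm (W0 \<omega>)" "norm \<mu>"] by (simp add: power2_sum)
      finally show ?thesis .
    qed
    have c2: "integrable M (\<lambda>\<omega>. (norm (W0 \<omega> - \<mu>))\<^sup>2)"
      by (rule Bochner_Integration.integrable_bound
          [where f = "\<lambda>\<omega>. 2 * (norm (W0 \<omega>))\<^sup>2 + 2 * (norm \<mu>)\<^sup>2"])
        (use W2 in \<open>auto intro: order_trans[OF pw] abs_ge_self\<close>)
    have "norm \<mu> \<le> J * \<phi>" using m1 integral_norm_bound[of M W0] unfolding \<mu>_def by linarith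
    then have "(norm \<mu>)\<^sup>2 \<le> (J * \<phi>)\<^sup>2" by (intro power_mono) auto
    also have "\<dots> = J\<^sup>2 * \<phi>\<^sup>2" by (rule power_mult_distrib)
    also have "\<dots> \<le> J\<^sup>2 * \<phi>"
      using \<phi> power_decreasing[of 1 2 \<phi>] by (intro mult_left_mono) auto
    finally have \<mu>2: "(norm \<mu>)\<^sup>2 \<le> J\<^sup>2 * \<phi>" .
    have "expectation (\<lambda>\<omega>. (norm (W0 \<omega> - \<mu>))\<^sup>2)
        \<le> expectation (\<lambda>\<omega>. 2 * (norm (W0 \<omega>))\<^sup>2 + 2 * (norm \<mu>)\<^sup>2)"
      using W2 c2 pw by (intro integral_mono) auto
    also have "\<dots> = 2 * expectation (\<lambda>\<omega>. (norm (W0 \<omega>))\<^sup>2) + 2 * (norm \<mu>)\<^sup>2"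
      using W2 by (simp add: prob_space)
    also have "\<dots> \<le> J2 * \<phi>" using m2 \<mu>2 by (simp add: J2_def algebra_simps)
    finally have var: "expectation (\<lambda>\<omega>. (norm (W0 \<omega> - \<mu>))\<^sup>2) \<le> J2 * \<phi>" .
    have Z2: "integrable M (\<lambda>\<omega>. (norm (Z i \<omega>))\<^sup>2)"
      "expectation (\<lambda>\<omega>. (norm (Z i \<omega>))\<^sup>2) \<le> J2 * \<phi>" if "i \<in> {1..n}" for i
      using tr[OF that, of "\<lambda>w. (norm (w - \<mu>))\<^sup>2"] c2 var by (simp_all add: Z_def)
    have Z0: "(\<integral>\<omega>. Z i \<omega> \<partial>M) = 0" if "i \<in> {1..n}" for i
      using tr[OF that, of "\<lambda>w. w - \<mu>"] W1 by (simp add: Z_def \<mu>_def prob_space)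
    have sumZ: "(\<Sum>i=1..n. Z i \<omega>) = (\<Sum>i=1..n. W i \<omega>) - real n *\<^sub>R \<mu>" for \<omega>
      by (simp add: Z_def sum_subtractf scaleR_conv_of_real sum_constant_scaleR)
    have [measurable]: "(\<lambda>\<omega>. \<Sum>i=1..n. Z i \<omega>) \<in> borel_measurable M"
      unfolding Z_def by (intro borel_measurable_sum borel_measurable_diff Wm) auto
    have sum_int: "integrable M (\<lambda>\<omega>. (norm (\<Sum>i=1..n. Z i \<omega>))\<^sup>2)"
    proof (rule Bochner_Integration.integrable_bound)
      show "integrable M (\<lambda>\<omega>. real n * (\<Sum>i=1..n. (norm (Z i \<omega>))\<^sup>2))"
        using Z2 by auto
      have "(norm (\<Sum>i=1..n. Z i \<omega>))\<^sup>2 \<le> real n * (\<Sum>i=1..n. (norm (Z i \<omega>))\<^sup>2)" for \<omega>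
      proof -
        have "(norm (\<Sum>i=1..n. Z i \<omega>))\<^sup>2 \<le> (\<Sum>i=1..n. norm (Z i \<omega>))\<^sup>2"
          by (intro power_mono norm_sum) simp
        also have "\<dots> \<le> real n * (\<Sum>i=1..n. (norm (Z i \<omega>))\<^sup>2)"
          using sum_squared_le_sum_of_squares[of "\<lambda>i. norm (Z i \<omega>)" "{1..n}"] by (simp add: mult.commute)
        finally show ?thesis .
      qed
      then show "AE \<omega> in M. norm ((norm (\<Sum>i=1..n. Z i \<omega>))\<^sup>2) \<le> norm (real n * (\<Sum>i=1..n. (norm (Z i \<omega>))\<^sup>2))"
        by (auto intro: order_trans[OF _ abs_ge_self])
    qed measurable
    have pos: "0 < A * sqrt (n * \<phi>)" using A \<phi> n by simp
    have "prob {\<omega>\<in>space M. A * sqrt (n * \<phi>) \<le> norm (\<Sum>i=1..n. Z i \<omega>)}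
        = prob {\<omega>\<in>space M. (A * sqrt (n * \<phi>))\<^sup>2 \<le> (norm (\<Sum>i=1..n. Z i \<omega>))\<^sup>2}"
      using pos by (intro arg_cong[where f = prob] Collect_cong conj_cong refl)
        (metis abs_le_square_iff abs_norm_cancel abs_of_pos)
    also have "\<dots> \<le> expectation (\<lambda>\<omega>. (norm (\<Sum>i=1..n. Z i \<omega>))\<^sup>2) / (A * sqrt (n * \<phi>))\<^sup>2"
      using pos sum_int n \<phi> A
      by (intro integral_Markov_inequality_measure[where A = "{}"]) auto
    also have "\<dots> \<le> (c0 * (n * (J2 * \<phi>))) / (A * sqrt (n * \<phi>))\<^sup>2"
    proof (rule divide_right_mono)
      have "expectation (\<lambda>\<omega>. (norm (\<Sum>i=1..n. Z i \<omega>))\<^sup>2)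
          \<le> c0 * (\<Sum>i=1..n. expectation (\<lambda>\<omega>. (norm (Z i \<omega>))\<^sup>2))"
        by (rule bd[OF prob_space_axioms indepZ Z2(1) Z0])
      also have "\<dots> \<le> c0 * (\<Sum>i=1..n. J2 * \<phi>)"
        using c0 Z2 by (intro mult_left_mono sum_mono) auto
      finally show "expectation (\<lambda>\<omega>. (norm (\<Sum>i=1..n. Z i \<omega>))\<^sup>2) \<le> c0 * (n * (J2 * \<phi>))" by simp
    qed simp
    also have "\<dots> = J2 / (2 * (J2 + 1))"
      using \<phi> n c0 J2 by (simp add: power_mult_distrib A)
    also have "\<dots> \<le> 1 / 2" using J2 by simp
    finally show "prob {\<omega>\<in>space M. A * sqrt (n * \<phi>) \<le> norm ((\<Sum>i=1..n. W i \<omega>) - real n *\<^sub>R expectation W0)} \<le> 1 / 2"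
      unfolding sumZ \<mu>_def .
  qed
qed

section \<open>A single observation\<close>

locale kernel_model = prob_space M for M :: "'w measure" +
  fixes N :: "'r measure" and X0 :: "'w \<Rightarrow> 'c::polish_space" and Y0 :: "'w \<Rightarrow> 'r"
    and \<kappa> :: "'c \<Rightarrow> 'r measure" and x :: 'c
    and L :: "'g::{banach, second_countable_topology} \<Rightarrow>\<^sub>L 'b::{banach, second_countable_topology}"
    and F :: "'c \<Rightarrow> 'g" and G :: "'r \<Rightarrow> 'g" and K :: "real \<Rightarrow> real" and l_K L_K :: real
  assumes X0 [measurable]: "X0 \<in> M \<rightarrow>\<^sub>M borel" and Y0 [measurable]: "Y0 \<in> M \<rightarrow>\<^sub>M N"
    and cond_distr: "regular_cond_distr M X0 Y0 N \<kappa>"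
    and F [measurable]: "F \<in> borel_measurable borel" and G [measurable]: "G \<in> borel_measurable N"
    and K [measurable]: "K \<in> borel_measurable (restrict_space borel {0..})"
    and kernel_bounds: "0 < l_K" "l_K \<le> L_K"
      "\<And>u. 0 \<le> u \<Longrightarrow> u \<le> 1 \<Longrightarrow> l_K \<le> K u \<and> K u \<le> L_K" "\<And>u. 1 < u \<Longrightarrow> K u = 0"
begin

section \<open>Disintegration along the conditional distribution\<close>

lemma kappa_measurable [measurable]: "\<kappa> \<in> borel \<rightarrow>\<^sub>M subprob_algebra N"
  using cond_distr unfolding regular_cond_distr_def by (blast intro: measurable_prob_algebraD)

lemma kappa: "prob_space (\<kappa> z)" "sets (\<kappa> z) = sets N"
proof -
  have "\<kappa> \<in> borel \<rightarrow>\<^sub>M prob_algebra N"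
    using cond_distr unfolding regular_cond_distr_def by blast
  then have "\<kappa> z \<in> space (prob_algebra N)" by (rule measurable_space) simp
  then show "prob_space (\<kappa> z)" "sets (\<kappa> z) = sets N" by (simp_all add: space_prob_algebra)
qed

lemma measurable_kappa_iff [simp]: "measurable (\<kappa> z) A = measurable N A"
  by (rule measurable_cong_sets) (simp_all add: kappa)

text \<open>The conditional distribution is specified on measurable rectangles only; these form an
  intersection stable generator, so they determine the joint law. Written as a \<open>bind\<close>,
  that law admits iterated integrals.\<close>

lemma joint_distr_eq_bind:
  "distr M (borel \<Otimes>\<^sub>M N) (\<lambda>\<omega>. (X0 \<omega>, Y0 \<omega>))
    = distr M borel X0 \<bind> (\<lambda>z. distr (\<kappa> z) (borel \<Otimes>\<^sub>M N) (\<lambda>y. (z, y)))" (is "?P = ?Q")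
proof -
  have Qk: "(\<lambda>z. distr (\<kappa> z) (borel \<Otimes>\<^sub>M N) (\<lambda>y. (z, y))) \<in> distr M borel X0 \<rightarrow>\<^sub>M subprob_algebra (borel \<Otimes>\<^sub>M N)"
    by (simp, rule measurable_distr2[where M = N]) measurable
  have sQ: "sets ?Q = sets (borel \<Otimes>\<^sub>M N)"
    by (rule sets_bind[OF sets_kernel[OF Qk]]) auto
  show ?thesis
  proof (rule measure_eqI_generator_eq[OF Int_stable_pair_measure_generator[of borel N],
      where A = "\<lambda>_. space borel \<times> space N"])
    show "{a \<times> b |a b. a \<in> sets borel \<and> b \<in> sets N} \<subseteq> Pow (space borel \<times> space N)"
      by (rule pair_measure_closed)
    show "sets ?P = sigma_sets (space borel \<times> space N) {a \<times> b |a b. a \<in> sets borel \<and> b \<in> sets N}"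
      by (simp add: sets_pair_measure)
    show "sets ?Q = sigma_sets (space borel \<times> space N) {a \<times> b |a b. a \<in> sets borel \<and> b \<in> sets N}"
      unfolding sQ by (rule sets_pair_measure)
    fix S :: "('c \<times> 'r) set"
    assume "S \<in> {a \<times> b |a b. a \<in> sets borel \<and> b \<in> sets N}"
    then obtain A B where S: "S = A \<times> B" and A[measurable]: "A \<in> sets borel" and B[measurable]: "B \<in> sets N" by blast
    have "emeasure ?P S = emeasure M {\<omega>\<in>space M. X0 \<omega> \<in> A \<and> Y0 \<omega> \<in> B}"
      unfolding S by (subst emeasure_distr) (auto intro!: arg_cong[where f = "emeasure M"])
    also have "\<dots> = (\<integral>\<^sup>+z\<in>A. emeasure (\<kappa> z) B \<partial>distr M borel X0)"
      using cond_distr A B unfolding regular_cond_distr_def by blast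
    also have "\<dots> = (\<integral>\<^sup>+z. emeasure (distr (\<kappa> z) (borel \<Otimes>\<^sub>M N) (\<lambda>y. (z, y))) S \<partial>distr M borel X0)"
    proof (intro nn_integral_cong)
      fix z
      have "emeasure (distr (\<kappa> z) (borel \<Otimes>\<^sub>M N) (\<lambda>y. (z, y))) S
          = emeasure (\<kappa> z) ((\<lambda>y. (z, y)) -` S \<inter> space (\<kappa> z))"
        unfolding S by (subst emeasure_distr) auto
      also have "(\<lambda>y. (z, y)) -` S \<inter> space (\<kappa> z) = (if z \<in> A then B else {})"
        using sets.sets_into_space[OF B] sets_eq_imp_space_eq[OF kappa(2)[of z]] by (auto simp: S)
      finally show "emeasure (\<kappa> z) B * indicator A z = emeasure (distr (\<kappa> z) (borel \<Otimes>\<^sub>M N) (\<lambda>y. (z, y))) S"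
        by simp
    qed
    also have "\<dots> = emeasure ?Q S"
      by (subst emeasure_bind[OF _ Qk]) (auto simp: S)
    finally show "emeasure ?P S = emeasure ?Q S" .
  next
    show "emeasure ?P (space borel \<times> space N) \<noteq> \<infinity>" for i :: nat
      by (subst emeasure_distr) (auto simp: emeasure_eq_measure)
    show "range (\<lambda>_. space borel \<times> space N) \<subseteq> {a \<times> b |a b. a \<in> sets borel \<and> b \<in> sets N}"
      by blast
  qed auto
qed

lemma nn_integral_disintegrate:
  assumes f [measurable]: "f \<in> borel_measurable (borel \<Otimes>\<^sub>M N)"
  shows "(\<integral>\<^sup>+\<omega>. f (X0 \<omega>, Y0 \<omega>) \<partial>M) = (\<integral>\<^sup>+\<omega>. \<integral>\<^sup>+y. f (X0 \<omega>, y) \<partial>\<kappa> (X0 \<omega>) \<partial>M)"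
proof -
  have Qk: "(\<lambda>z. distr (\<kappa> z) (borel \<Otimes>\<^sub>M N) (\<lambda>y. (z, y))) \<in> distr M borel X0 \<rightarrow>\<^sub>M subprob_algebra (borel \<Otimes>\<^sub>M N)"
    by (simp, rule measurable_distr2[where M = N]) measurable
  have inner [measurable]: "(\<lambda>z. \<integral>\<^sup>+y. f (z, y) \<partial>\<kappa> z) \<in> borel_measurable borel"
    by (rule nn_integral_measurable_subprob_algebra2[where N = N]) simp_all
  have "(\<integral>\<^sup>+\<omega>. f (X0 \<omega>, Y0 \<omega>) \<partial>M) = (\<integral>\<^sup>+v. f v \<partial>distr M (borel \<Otimes>\<^sub>M N) (\<lambda>\<omega>. (X0 \<omega>, Y0 \<omega>)))"
    by (subst nn_integral_distr) auto
  also have "\<dots> = (\<integral>\<^sup>+z. \<integral>\<^sup>+v. f v \<partial>distr (\<kappa> z) (borel \<Otimes>\<^sub>M N) (\<lambda>y. (z, y)) \<partial>distr M borel X0)"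
    unfolding joint_distr_eq_bind by (rule nn_integral_bind[OF f Qk])
  also have "\<dots> = (\<integral>\<^sup>+z. \<integral>\<^sup>+y. f (z, y) \<partial>\<kappa> z \<partial>distr M borel X0)"
    by (intro nn_integral_cong nn_integral_distr) auto
  also have "\<dots> = (\<integral>\<^sup>+\<omega>. \<integral>\<^sup>+y. f (X0 \<omega>, y) \<partial>\<kappa> (X0 \<omega>) \<partial>M)"
    by (subst nn_integral_distr) auto
  finally show ?thesis .
qed

text \<open>A vanishing conditional mean says that the positive and negative parts have equal finite
  conditional integrals. Disintegrating each part as a nonnegative function keeps them
  equal.\<close>

lemma integral_eq_0_of_cond_integral_eq_0:
  fixes u :: "'c \<times> 'r \<Rightarrow> real"
  assumes u [measurable]: "u \<in> borel_measurable (borel \<Otimes>\<^sub>M N)"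
    and int: "integrable M (\<lambda>\<omega>. u (X0 \<omega>, Y0 \<omega>))"
    and cond: "\<And>z. integrable (\<kappa> z) (\<lambda>y. u (z, y))" "\<And>z. (\<integral>y. u (z, y) \<partial>\<kappa> z) = 0"
  shows "expectation (\<lambda>\<omega>. u (X0 \<omega>, Y0 \<omega>)) = 0"
proof -
  have "(\<integral>\<^sup>+y. ennreal (u (z, y)) \<partial>\<kappa> z) = (\<integral>\<^sup>+y. ennreal (- u (z, y)) \<partial>\<kappa> z)" for z
  proof -
    have fin: "(\<integral>\<^sup>+y. ennreal (u (z, y)) \<partial>\<kappa> z) \<noteq> \<infinity>" "(\<integral>\<^sup>+y. ennreal (- u (z, y)) \<partial>\<kappa> z) \<noteq> \<infinity>"
      using cond(1)[of z] by (auto simp: real_integrable_def)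
    have "enn2real (\<integral>\<^sup>+y. ennreal (u (z, y)) \<partial>\<kappa> z) = enn2real (\<integral>\<^sup>+y. ennreal (- u (z, y)) \<partial>\<kappa> z)"
      using cond(2)[of z] real_lebesgue_integral_def[OF cond(1)[of z]] by simp
    then show ?thesis
      using fin by (metis ennreal_enn2real infinity_ennreal_def less_top)
  qed
  then have "(\<integral>\<^sup>+\<omega>. ennreal (u (X0 \<omega>, Y0 \<omega>)) \<partial>M) = (\<integral>\<^sup>+\<omega>. ennreal (- u (X0 \<omega>, Y0 \<omega>)) \<partial>M)"
    using nn_integral_disintegrate[of "\<lambda>v. ennreal (u v)"]
      nn_integral_disintegrate[of "\<lambda>v. ennreal (- u v)"] by simp
  then show ?thesis using real_lebesgue_integral_def[OF int] by simp
qed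

section \<open>Kernel weights and the small ball probability\<close>

lemma kernel_weight_measurable [measurable]:
  assumes "0 < r" shows "kernel_weight K x r \<in> borel_measurable borel"
proof -
  have "(\<lambda>z. inverse r * dist x z) \<in> borel \<rightarrow>\<^sub>M restrict_space borel {0..}"
    using assms by (intro measurable_restrict_space2) auto
  then show ?thesis unfolding kernel_weight_def by (rule measurable_compose) (rule K)
qed

lemma kernel_weight_bounds:
  assumes "0 < r"
  shows "dist x z \<le> r \<Longrightarrow> l_K \<le> kernel_weight K x r z" "kernel_weight K x r z \<le> L_K"
    "0 \<le> kernel_weight K x r z" "r < dist x z \<Longrightarrow> kernel_weight K x r z = 0"
proof -
  have iff: "inverse r * dist x z \<le> 1 \<longleftrightarrow> dist x z \<le> r" "0 \<le> inverse r * dist x z"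
    using assms by (auto simp: field_simps)
  then show "dist x z \<le> r \<Longrightarrow> l_K \<le> kernel_weight K x r z"
    and z: "r < dist x z \<Longrightarrow> kernel_weight K x r z = 0"
    using kernel_bounds by (auto simp: kernel_weight_def)
  show "kernel_weight K x r z \<le> L_K" "0 \<le> kernel_weight K x r z"
    using iff kernel_bounds(3)[of "inverse r * dist x z"] kernel_bounds(1,2) z
    by (cases "dist x z \<le> r"; fastforce simp: kernel_weight_def)+
qed

lemma small_ball_eq_integral:
  "integrable M (\<lambda>\<omega>. indicat_real {z. dist x z \<le> r} (X0 \<omega>))"
  "expectation (\<lambda>\<omega>. indicat_real {z. dist x z \<le> r} (X0 \<omega>)) = small_ball M X0 x r"
proof -
  have "indicat_real {z. dist x z \<le> r} (X0 \<omega>) = indicat_real {\<omega>\<in>space M. dist x (X0 \<omega>) \<le> r} \<omega>"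
    if "\<omega> \<in> space M" for \<omega> using that by (auto simp: indicator_def)
  then have "expectation (\<lambda>\<omega>. indicat_real {z. dist x z \<le> r} (X0 \<omega>))
      = expectation (indicat_real {\<omega>\<in>space M. dist x (X0 \<omega>) \<le> r})"
    by (intro Bochner_Integration.integral_cong) auto
  also have "\<dots> = small_ball M X0 x r"
    by (simp add: small_ball_def Int_def conj_commute)
  finally show "expectation (\<lambda>\<omega>. indicat_real {z. dist x z \<le> r} (X0 \<omega>)) = small_ball M X0 x r" .
  show "integrable M (\<lambda>\<omega>. indicat_real {z. dist x z \<le> r} (X0 \<omega>))"
    by (intro integrable_const_bound[of _ 1]) (auto simp: indicator_def)
qed

text \<open>The weight lies between \<open>l_K\<close> and \<open>L_K\<close> times the indicator of
  the ball, which is why its mean and the small ball probability have the same order.\<close>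

lemma kernel_weight_expectation:
  assumes r: "0 < r"
  shows "integrable M (\<lambda>\<omega>. kernel_weight K x r (X0 \<omega>))"
    "l_K * small_ball M X0 x r \<le> expectation (\<lambda>\<omega>. kernel_weight K x r (X0 \<omega>))"
    "expectation (\<lambda>\<omega>. kernel_weight K x r (X0 \<omega>)) \<le> L_K * small_ball M X0 x r"
proof -
  note b = kernel_weight_bounds[OF r]
  note [measurable] = kernel_weight_measurable[OF r]
  show int: "integrable M (\<lambda>\<omega>. kernel_weight K x r (X0 \<omega>))"
    by (intro integrable_const_bound[of _ L_K]) (auto simp: b)
  have "l_K * indicat_real {z. dist x z \<le> r} z \<le> kernel_weight K x r z"
    "kernel_weight K x r z \<le> L_K * indicat_real {z. dist x z \<le> r} z" for z
    using b[of z] by (auto simp: indicator_def not_le)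
  then have "expectation (\<lambda>\<omega>. l_K * indicat_real {z. dist x z \<le> r} (X0 \<omega>))
      \<le> expectation (\<lambda>\<omega>. kernel_weight K x r (X0 \<omega>))"
    "expectation (\<lambda>\<omega>. kernel_weight K x r (X0 \<omega>))
      \<le> expectation (\<lambda>\<omega>. L_K * indicat_real {z. dist x z \<le> r} (X0 \<omega>))"
    using int small_ball_eq_integral(1) by (intro integral_mono integrable_mult_right; simp)+
  then show "l_K * small_ball M X0 x r \<le> expectation (\<lambda>\<omega>. kernel_weight K x r (X0 \<omega>))"
    "expectation (\<lambda>\<omega>. kernel_weight K x r (X0 \<omega>)) \<le> L_K * small_ball M X0 x r"
    by (simp_all add: small_ball_eq_integral(2))
qed

definition cond_mean :: "'c \<Rightarrow> 'g" where "cond_mean z = (\<integral>y. G y \<partial>\<kappa> z)"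

lemma cond_mean_measurable [measurable]: "cond_mean \<in> borel_measurable borel"
  unfolding cond_mean_def by measurable

text \<open>Bias and noise carry the same weight, so one observation contributes a single term;
  subtracting \<open>F x\<close> inside it turns the estimator error into a ratio of sums.\<close>

definition summand :: "real \<Rightarrow> 'c \<times> 'r \<Rightarrow> 'b" where
  "summand r v = kernel_weight K x r (fst v) *\<^sub>R
     blinfun_apply L (F (fst v) - F x + (G (snd v) - cond_mean (fst v)))"

lemma summand_measurable [measurable]:
  assumes "0 < r" shows "summand r \<in> borel_measurable (borel \<Otimes>\<^sub>M N)"
proof -
  note [measurable] = kernel_weight_measurable[OF assms]
  have [measurable]: "blinfun_apply L \<in> borel_measurable borel"
    by (intro borel_measurable_continuous_onI continuous_intros)
  show ?thesis unfolding summand_def by measurable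
qed

end

text \<open>One fixed radius. The neighbourhood assumptions are frozen on the closed ball of radius
  \<open>r\<close>, outside of which all weights vanish; \<open>b\<close>, \<open>C\<close> and
  \<open>\<sigma>\<close> are parameters that can stay the same for all small radii, which makes the
  resulting bounds uniform.\<close>

locale kernel_model_ball = kernel_model M N X0 Y0 \<kappa> x L F G K l_K L_K
  for M :: "'w measure" and N :: "'r measure" and X0 :: "'w \<Rightarrow> 'c::polish_space" and Y0 :: "'w \<Rightarrow> 'r"
    and \<kappa> :: "'c \<Rightarrow> 'r measure" and x :: 'c
    and L :: "'g::{banach, second_countable_topology} \<Rightarrow>\<^sub>L 'b::{banach, second_countable_topology}"
    and F :: "'c \<Rightarrow> 'g" and G :: "'r \<Rightarrow> 'g" and K :: "real \<Rightarrow> real" and l_K L_K :: real +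
  fixes r b C \<nu> \<sigma> :: real and \<psi> :: "'b \<Rightarrow>\<^sub>L real"
  assumes r: "0 < r" and b: "0 \<le> b" and C: "0 \<le> C" and \<nu>: "2 < \<nu>" and \<sigma>: "0 < \<sigma>"
    and F_near: "\<And>z. dist x z \<le> r \<Longrightarrow> norm (F z - F x) \<le> b"
    and G_near: "\<And>z. dist x z \<le> r \<Longrightarrow> integrable (\<kappa> z) G"
    and moment_near: "\<And>z. dist x z \<le> r \<Longrightarrow>
      (\<integral>\<^sup>+y. ennreal (norm (G y - cond_mean z) powr \<nu>) \<partial>\<kappa> z) \<le> ennreal C"
    and variance_near: "\<And>z. dist x z \<le> r \<Longrightarrow> \<sigma> \<le> cond_coord_variance \<psi> L G \<kappa> z"
begin

section \<open>Moments, variance and mean of one summand\<close>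

abbreviation k where "k \<equiv> kernel_weight K x r"
abbreviation W0 where "W0 \<omega> \<equiv> summand r (X0 \<omega>, Y0 \<omega>)"
abbreviation \<phi> where "\<phi> \<equiv> small_ball M X0 x r"

lemmas [measurable] = kernel_weight_measurable[OF r] summand_measurable[OF r]

lemma L_measurable [measurable]: "blinfun_apply L \<in> borel_measurable borel"
  by (intro borel_measurable_continuous_onI continuous_intros)

lemma psi_measurable [measurable]: "blinfun_apply \<psi> \<in> borel_measurable borel"
  by (intro borel_measurable_continuous_onI continuous_intros)

text \<open>Raising the exponent from \<open>p\<close> to \<open>\<nu>\<close> is paid for by the
  summand 1, as \<open>g powr p \<le> 1 + g powr \<nu>\<close>. The indicator later produces the
  factor \<open>\<phi>\<close>.\<close>

lemma norm_summand_powr_le: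
  assumes p: "0 < p" "p \<le> \<nu>"
  shows "norm (summand r (z, y)) powr p \<le> (2 * (L_K * norm L)) powr p
    * (b powr p + 1 + norm (G y - cond_mean z) powr \<nu>) * indicat_real {z. dist x z \<le> r} z"
proof (cases "dist x z \<le> r")
  case False
  then show ?thesis using kernel_weight_bounds(4)[OF r, of z] by (simp add: summand_def)
next
  case True
  define g where "g = norm (G y - cond_mean z)"
  have g: "0 \<le> g" by (simp add: g_def)
  have "norm (summand r (z, y)) \<le> L_K * (norm L * (b + g))"
  proof -
    have "norm (blinfun_apply L (F z - F x + (G y - cond_mean z))) \<le> norm L * norm (F z - F x + (G y - cond_mean z))"
      by (rule norm_blinfun)
    also have "\<dots> \<le> norm L * (b + g)"
      using F_near[OF True] unfolding g_def
      by (intro mult_left_mono order_trans[OF norm_triangle_ineq] add_mono) auto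
    finally show ?thesis
      using kernel_weight_bounds[OF r, of z] by (auto simp: summand_def intro!: mult_mono)
  qed
  then have "norm (summand r (z, y)) powr p \<le> ((L_K * norm L) * (b + g)) powr p"
    using p by (intro powr_mono2) (auto simp: mult.assoc)
  also have "\<dots> = (L_K * norm L) powr p * (b + g) powr p"
    by (rule powr_mult)
  also have "\<dots> \<le> (L_K * norm L) powr p * (2 powr p * (b powr p + g powr p))"
    using b g p by (intro mult_left_mono powr_add_le_2_powr) auto
  also have "g powr p \<le> 1 + g powr \<nu>"
  proof (cases "g \<le> 1")
    case True
    then have "g powr p \<le> 1 powr p" using g p by (intro powr_mono2) auto
    then show ?thesis using powr_ge_zero[of g \<nu>] by (simp del: powr_ge_zero)
  next
    case False
    then have "g powr p \<le> g powr \<nu>" using p by (intro powr_mono) auto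
    then show ?thesis by simp
  qed
  also have "(L_K * norm L) powr p * (2 powr p * (b powr p + (1 + g powr \<nu>)))
      = (2 * (L_K * norm L)) powr p * (b powr p + 1 + g powr \<nu>)"
    using kernel_bounds by (subst powr_mult[of 2]) (auto simp: algebra_simps)
  finally show ?thesis using True by (simp add: g_def mult_left_mono)
qed

text \<open>Free of \<open>r\<close>: the radius enters the moment bounds only through
  \<open>\<phi>\<close>.\<close>

definition moment_const :: "real \<Rightarrow> real" where
  "moment_const p = (2 * (L_K * norm L)) powr p * (b powr p + 1 + C)"

lemma moment_const_nonneg: "0 \<le> moment_const p"
  using C by (simp add: moment_const_def)

text \<open>Given the covariate, the moment is at most a constant inside the ball and 0 outside, so
  every order up to \<open>\<nu>\<close> yields the same first power of
  \<open>\<phi>\<close>.\<close>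

lemma summand_moment:
  assumes p: "0 < p" "p \<le> \<nu>"
  shows "integrable M (\<lambda>\<omega>. norm (W0 \<omega>) powr p)"
    and "expectation (\<lambda>\<omega>. norm (W0 \<omega>) powr p) \<le> moment_const p * \<phi>"
proof -
  have "(\<integral>\<^sup>+\<omega>. ennreal (norm (W0 \<omega>) powr p) \<partial>M)
      = (\<integral>\<^sup>+\<omega>. \<integral>\<^sup>+y. ennreal (norm (summand r (X0 \<omega>, y)) powr p) \<partial>\<kappa> (X0 \<omega>) \<partial>M)"
    by (rule nn_integral_disintegrate[of "\<lambda>v. ennreal (norm (summand r v) powr p)"]) measurable
  also have "\<dots> \<le> (\<integral>\<^sup>+\<omega>. ennreal (moment_const p * indicat_real {z. dist x z \<le> r} (X0 \<omega>)) \<partial>M)"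
  proof (rule nn_integral_mono)
    fix \<omega>
    define z where "z = X0 \<omega>"
    interpret kz: prob_space "\<kappa> z" by (rule kappa)
    define a where "a = (2 * (L_K * norm L)) powr p"
    define B where "B = b powr p + 1"
    have a: "0 \<le> a" "0 \<le> B" by (simp_all add: a_def B_def)
    show "(\<integral>\<^sup>+y. ennreal (norm (summand r (X0 \<omega>, y)) powr p) \<partial>\<kappa> (X0 \<omega>))
        \<le> ennreal (moment_const p * indicat_real {z. dist x z \<le> r} (X0 \<omega>))"
    proof (cases "dist x z \<le> r")
      case True
      have "(\<integral>\<^sup>+y. ennreal (norm (summand r (z, y)) powr p) \<partial>\<kappa> z)
          \<le> (\<integral>\<^sup>+y. ennreal a * (ennreal B + ennreal (norm (G y - cond_mean z) powr \<nu>)) \<partial>\<kappa> z)"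
        using norm_summand_powr_le[OF p, of z] True a
        by (intro nn_integral_mono) (simp add: a_def B_def ennreal_mult'[symmetric] ennreal_plus[symmetric] del: ennreal_plus)
      also have "\<dots> = ennreal a * (ennreal B + (\<integral>\<^sup>+y. ennreal (norm (G y - cond_mean z) powr \<nu>) \<partial>\<kappa> z))"
        by (subst nn_integral_cmult, simp, subst nn_integral_add) (simp_all add: kz.emeasure_space_1)
      also have "\<dots> \<le> ennreal a * (ennreal B + ennreal C)"
        using moment_near[OF True] by (intro mult_left_mono add_left_mono) auto
      also have "\<dots> = ennreal (moment_const p)"
        using a C by (simp add: moment_const_def a_def B_def ennreal_mult'[symmetric] ennreal_plus[symmetric] del: ennreal_plus)
      finally show ?thesis using True by (simp add: z_def)
    next
      case False
      then have "summand r (z, y) = 0" for y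
        using kernel_weight_bounds(4)[OF r, of z] by (simp add: summand_def)
      then show ?thesis by (simp add: z_def)
    qed
  qed
  also have "\<dots> = ennreal (moment_const p * \<phi>)"
    using moment_const_nonneg[of p] small_ball_eq_integral[of r]
    by (subst nn_integral_eq_integral) auto
  finally have le: "(\<integral>\<^sup>+\<omega>. ennreal (norm (W0 \<omega>) powr p) \<partial>M) \<le> ennreal (moment_const p * \<phi>)" .
  show int: "integrable M (\<lambda>\<omega>. norm (W0 \<omega>) powr p)"
    by (rule integrableI_bounded) (use le in \<open>auto intro: le_less_trans\<close>)
  have "ennreal (expectation (\<lambda>\<omega>. norm (W0 \<omega>) powr p)) \<le> ennreal (moment_const p * \<phi>)"
    using le nn_integral_eq_integral[OF int] by simp
  then show "expectation (\<lambda>\<omega>. norm (W0 \<omega>) powr p) \<le> moment_const p * \<phi>"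
    using moment_const_nonneg[of p] by (subst (asm) ennreal_le_iff) (auto simp: small_ball_def)
qed

text \<open>Stated for any functional, since the mean of a summand is computed through all
  coordinates and not through \<open>\<psi>\<close> alone.\<close>

lemma integral_coord_noise:
  fixes \<psi>' :: "'b \<Rightarrow>\<^sub>L real"
  assumes "dist x z \<le> r"
  shows "integrable (\<kappa> z) (\<lambda>y. \<psi>' (L (G y - cond_mean z)))"
    and "(\<integral>y. \<psi>' (L (G y - cond_mean z)) \<partial>\<kappa> z) = 0"
proof -
  interpret kz: prob_space "\<kappa> z" by (rule kappa)
  have int: "integrable (\<kappa> z) (\<lambda>y. G y - cond_mean z)" using G_near[OF assms] by simp
  have bl: "bounded_linear (\<lambda>v. \<psi>' (L v))"
    by (intro bounded_linear_compose[OF blinfun.bounded_linear_right] blinfun.bounded_linear_right)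
  show "integrable (\<kappa> z) (\<lambda>y. \<psi>' (L (G y - cond_mean z)))"
    by (rule integrable_bounded_linear[OF bl int])
  have "(\<integral>y. \<psi>' (L (G y - cond_mean z)) \<partial>\<kappa> z) = \<psi>' (L (\<integral>y. G y - cond_mean z \<partial>\<kappa> z))"
    by (rule integral_bounded_linear[OF bl int])
  also have "(\<integral>y. G y - cond_mean z \<partial>\<kappa> z) = 0"
    using G_near[OF assms] by (simp add: kz.prob_space cond_mean_def)
  finally show "(\<integral>y. \<psi>' (L (G y - cond_mean z)) \<partial>\<kappa> z) = 0" by (simp add: blinfun.zero_right)
qed

lemma coord_summand_integrable:
  "integrable M W0" "integrable M (\<lambda>\<omega>. (norm (W0 \<omega>))\<^sup>2)"
  "integrable M (\<lambda>\<omega>. \<psi> (W0 \<omega>))" "integrable M (\<lambda>\<omega>. (\<psi> (W0 \<omega>))\<^sup>2)"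
proof -
  have "integrable M (\<lambda>\<omega>. norm (W0 \<omega>))" using summand_moment(1)[of 1] \<nu> by simp
  then show W: "integrable M W0" by (simp add: integrable_norm_iff)
  show W2: "integrable M (\<lambda>\<omega>. (norm (W0 \<omega>))\<^sup>2)"
    using summand_moment(1)[of 2] \<nu> by (simp add: powr_numeral)
  show "integrable M (\<lambda>\<omega>. \<psi> (W0 \<omega>))"
    by (rule integrable_bounded_linear[OF blinfun.bounded_linear_right W])
  show "integrable M (\<lambda>\<omega>. (\<psi> (W0 \<omega>))\<^sup>2)"
  proof (rule Bochner_Integration.integrable_bound)
    show "integrable M (\<lambda>\<omega>. (norm \<psi>)\<^sup>2 * (norm (W0 \<omega>))\<^sup>2)" using W2 by simp
    show "AE \<omega> in M. norm ((\<psi> (W0 \<omega>))\<^sup>2) \<le> norm ((norm \<psi>)\<^sup>2 * (norm (W0 \<omega>))\<^sup>2)"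
      using power_mono[OF norm_blinfun[of \<psi>], of _ 2]
      by (intro AE_I2) (simp add: power_mult_distrib)
  qed measurable
qed

text \<open>Given that the covariate is \<open>z\<close>, the noise is centred, so the cross term
  disappears and the mean square distance from any constant is at least \<open>(k z)\<^sup>2\<close>
  times the conditional variance. The bias part therefore cannot reduce it.\<close>

lemma coord_summand_variance:
  "l_K\<^sup>2 * \<sigma> * \<phi> \<le> variance (\<lambda>\<omega>. \<psi> (W0 \<omega>))"
proof -
  define \<mu> where "\<mu> = expectation (\<lambda>\<omega>. \<psi> (W0 \<omega>))"
  have inner: "ennreal (l_K\<^sup>2 * \<sigma>) \<le> (\<integral>\<^sup>+y. ennreal ((\<psi> (summand r (z, y)) - \<mu>)\<^sup>2) \<partial>\<kappa> z)"
    if z: "dist x z \<le> r" for z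
  proof -
    interpret kz: prob_space "\<kappa> z" by (rule kappa)
    define u where "u = (\<lambda>y. \<psi> (L (G y - cond_mean z)))"
    define a where "a = k z * \<psi> (L (F z - F x)) - \<mu>"
    have u2: "\<sigma> \<le> (\<integral>y. (u y)\<^sup>2 \<partial>\<kappa> z)"
      using variance_near[OF z] by (simp add: cond_coord_variance_def u_def cond_mean_def)
    \<comment> \<open>The Bochner integral of a non-integrable function is 0 by default, so the
      positive lower bound \<open>u2\<close> forces integrability.\<close>
    have int2: "integrable (\<kappa> z) (\<lambda>y. (u y)\<^sup>2)"
    proof (rule ccontr)
      assume "\<not> ?thesis"
      then show False using u2 \<sigma> by (simp add: not_integrable_integral_eq)
    qed
    have u1: "integrable (\<kappa> z) u" "(\<integral>y. u y \<partial>\<kappa> z) = 0"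
      using integral_coord_noise[OF z] by (simp_all add: u_def)
    have eq: "(\<psi> (summand r (z, y)) - \<mu>)\<^sup>2 = a\<^sup>2 + 2 * a * k z * u y + (k z)\<^sup>2 * (u y)\<^sup>2" for y
    proof -
      have "\<psi> (summand r (z, y)) - \<mu> = a + k z * u y"
        unfolding summand_def a_def u_def fst_conv snd_conv blinfun.scaleR_right blinfun.add_right
        by (simp add: distrib_left)
      then show ?thesis by (simp add: power2_eq_square algebra_simps)
    qed
    have int: "integrable (\<kappa> z) (\<lambda>y. (\<psi> (summand r (z, y)) - \<mu>)\<^sup>2)"
      unfolding eq using int2 u1 by simp
    have "l_K\<^sup>2 * \<sigma> \<le> (k z)\<^sup>2 * (\<integral>y. (u y)\<^sup>2 \<partial>\<kappa> z)"
      using kernel_weight_bounds(1)[OF r z] kernel_bounds u2 \<sigma> by (intro mult_mono power_mono) auto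
    also have "\<dots> \<le> a\<^sup>2 + \<dots>" by simp
    also have "\<dots> = (\<integral>y. (\<psi> (summand r (z, y)) - \<mu>)\<^sup>2 \<partial>\<kappa> z)"
      unfolding eq using int2 u1 by (simp add: kz.prob_space)
    finally show ?thesis
      by (subst nn_integral_eq_integral[OF int]) (auto intro: ennreal_leI)
  qed
  have int: "integrable M (\<lambda>\<omega>. (\<psi> (W0 \<omega>) - \<mu>)\<^sup>2)"
    unfolding power2_diff using coord_summand_integrable by simp
  have "ennreal (l_K\<^sup>2 * \<sigma> * \<phi>) = (\<integral>\<^sup>+\<omega>. ennreal (l_K\<^sup>2 * \<sigma> * indicat_real {z. dist x z \<le> r} (X0 \<omega>)) \<partial>M)"
    using \<sigma> small_ball_eq_integral[of r] by (subst nn_integral_eq_integral) auto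
  also have "\<dots> \<le> (\<integral>\<^sup>+\<omega>. \<integral>\<^sup>+y. ennreal ((\<psi> (summand r (X0 \<omega>, y)) - \<mu>)\<^sup>2) \<partial>\<kappa> (X0 \<omega>) \<partial>M)"
    by (intro nn_integral_mono) (use inner in \<open>auto simp: indicator_def\<close>)
  also have "\<dots> = (\<integral>\<^sup>+\<omega>. ennreal ((\<psi> (W0 \<omega>) - \<mu>)\<^sup>2) \<partial>M)"
    by (rule nn_integral_disintegrate[of "\<lambda>v. ennreal ((\<psi> (summand r v) - \<mu>)\<^sup>2)", symmetric]) measurable
  also have "\<dots> = ennreal (expectation (\<lambda>\<omega>. (\<psi> (W0 \<omega>) - \<mu>)\<^sup>2))"
    by (rule nn_integral_eq_integral[OF int]) auto
  finally show ?thesis by (simp add: \<mu>_def)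
qed

text \<open>The noise part has mean zero by the conditional centring; what remains is the numerator
  of \<open>mean_bias\<close>, whose denominator is the positive mean weight.\<close>

lemma expectation_summand:
  fixes \<psi>' :: "nat \<Rightarrow> 'b \<Rightarrow>\<^sub>L real"
  assumes coord: "coordinate_functionals d e \<psi>'" and \<phi>: "0 < \<phi>"
  shows "expectation W0 = expectation (\<lambda>\<omega>. k (X0 \<omega>)) *\<^sub>R mean_bias M X0 L F K x r"
proof -
  define Bz where "Bz = (\<lambda>\<omega>. k (X0 \<omega>) *\<^sub>R L (F (X0 \<omega>) - F x))"
  define T where "T = (\<lambda>v. k (fst v) *\<^sub>R L (G (snd v) - cond_mean (fst v)))"
  have [measurable]: "T \<in> borel_measurable (borel \<Otimes>\<^sub>M N)" unfolding T_def by measurable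
  have F_int: "integrable M (\<lambda>\<omega>. k (X0 \<omega>) *\<^sub>R (F (X0 \<omega>) - F x))"
  proof (rule integrable_const_bound[of _ "L_K * b"])
    have "norm (k z *\<^sub>R (F z - F x)) \<le> L_K * b" for z
    proof (cases "dist x z \<le> r")
      case True
      then show ?thesis
        using kernel_weight_bounds[OF r, of z] F_near[of z] by (auto intro!: mult_mono)
    next
      case False
      then show ?thesis using kernel_weight_bounds(4)[OF r, of z] kernel_bounds b by simp
    qed
    then show "AE \<omega> in M. norm (k (X0 \<omega>) *\<^sub>R (F (X0 \<omega>) - F x)) \<le> L_K * b" by simp
  qed measurable
  have B_eq: "Bz = (\<lambda>\<omega>. L (k (X0 \<omega>) *\<^sub>R (F (X0 \<omega>) - F x)))"
    by (simp add: Bz_def blinfun.scaleR_right)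
  have B_int: "integrable M Bz"
    unfolding B_eq by (rule integrable_bounded_linear[OF blinfun.bounded_linear_right F_int])
  have W_eq: "W0 \<omega> = Bz \<omega> + T (X0 \<omega>, Y0 \<omega>)" for \<omega>
    by (simp add: summand_def Bz_def T_def blinfun.add_right scaleR_add_right)
  then have T_eq: "T (X0 \<omega>, Y0 \<omega>) = W0 \<omega> - Bz \<omega>" for \<omega> by simp
  have T_int: "integrable M (\<lambda>\<omega>. T (X0 \<omega>, Y0 \<omega>))"
    unfolding T_eq using coord_summand_integrable(1) B_int by simp
  \<comment> \<open>The coordinate functionals separate points, which reduces the vanishing of this Bochner integral to
    real integrals, where only positive and negative parts need to be disintegrated.\<close>
  have "blinfun_apply (\<psi>' i) (expectation (\<lambda>\<omega>. T (X0 \<omega>, Y0 \<omega>))) = 0" for i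
  proof -
    have [measurable]: "blinfun_apply (\<psi>' i) \<in> borel_measurable borel"
      by (intro borel_measurable_continuous_onI continuous_intros)
    have cond: "integrable (\<kappa> z) (\<lambda>y. blinfun_apply (\<psi>' i) (T (z, y)))" "(\<integral>y. blinfun_apply (\<psi>' i) (T (z, y)) \<partial>\<kappa> z) = 0" for z
      using integral_coord_noise[of z "\<psi>' i"] kernel_weight_bounds(4)[OF r, of z]
      by (cases "dist x z \<le> r"; simp add: T_def blinfun.scaleR_right)+
    have "expectation (\<lambda>\<omega>. blinfun_apply (\<psi>' i) (T (X0 \<omega>, Y0 \<omega>))) = 0"
      using integral_eq_0_of_cond_integral_eq_0[of "\<lambda>v. blinfun_apply (\<psi>' i) (T v)"] cond
        integrable_bounded_linear[OF blinfun.bounded_linear_right[of "\<psi>' i"] T_int] by simp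
    then show ?thesis
      using integral_bounded_linear[OF blinfun.bounded_linear_right[of "\<psi>' i"] T_int] by simp
  qed
  then have "(\<lambda>i. 0) sums expectation (\<lambda>\<omega>. T (X0 \<omega>, Y0 \<omega>))"
    using coord[unfolded coordinate_functionals_def, rule_format, of "expectation (\<lambda>\<omega>. T (X0 \<omega>, Y0 \<omega>))"]
    by (simp cong: if_cong)
  then have T0: "expectation (\<lambda>\<omega>. T (X0 \<omega>, Y0 \<omega>)) = 0"
    using sums_unique2 sums_zero by blast
  define Ek where "Ek = expectation (\<lambda>\<omega>. k (X0 \<omega>))"
  have Ek: "0 < Ek"
    using kernel_weight_expectation(2)[OF r] kernel_bounds(1) \<phi> less_le_trans[OF mult_pos_pos]
    unfolding Ek_def by blast
  have "expectation W0 = expectation Bz"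
    unfolding W_eq using B_int T_int T0 by simp
  also have "\<dots> = L (expectation (\<lambda>\<omega>. k (X0 \<omega>) *\<^sub>R (F (X0 \<omega>) - F x)))"
    unfolding B_eq by (rule integral_bounded_linear[OF blinfun.bounded_linear_right F_int])
  also have "(\<lambda>\<omega>. k (X0 \<omega>) *\<^sub>R (F (X0 \<omega>) - F x)) = (\<lambda>\<omega>. Ek *\<^sub>R ((k (X0 \<omega>) / Ek) *\<^sub>R (F (X0 \<omega>) - F x)))"
    using Ek by simp
  also have "L (expectation \<dots>) = Ek *\<^sub>R mean_bias M X0 L F K x r"
    unfolding mean_bias_def Ek_def[symmetric] by (simp only: integral_scaleR_right blinfun.scaleR_right)
  finally show ?thesis by (simp add: Ek_def)
qed

end

section \<open>The sample\<close>

text \<open>The union bound in the form in which exceptional events are peeled off one after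
  another.\<close>

lemma (in prob_space) prob_ge_diff:
  assumes "E1 \<in> events" "E2 \<in> events" "E3 \<in> events" "E1 \<subseteq> E2 \<union> E3"
  shows "prob E1 - prob E2 \<le> prob E3"
  using finite_measure_mono[of E1 "E2 \<union> E3"] measure_Un_le[of E2 M E3] assms by simp

locale kernel_sample = kernel_model M N X0 Y0 \<kappa> x L F G K l_K L_K
  for M :: "'w measure" and N :: "'r measure" and X0 :: "'w \<Rightarrow> 'c::polish_space" and Y0 :: "'w \<Rightarrow> 'r"
    and \<kappa> :: "'c \<Rightarrow> 'r measure" and x :: 'c
    and L :: "'g::{banach, second_countable_topology} \<Rightarrow>\<^sub>L 'b::{banach, second_countable_topology}"
    and F :: "'c \<Rightarrow> 'g" and G :: "'r \<Rightarrow> 'g" and K :: "real \<Rightarrow> real" and l_K L_K :: real +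
  fixes X :: "nat \<Rightarrow> 'w \<Rightarrow> 'c" and Y :: "nat \<Rightarrow> 'w \<Rightarrow> 'r"
  assumes indep: "indep_vars (\<lambda>_. borel \<Otimes>\<^sub>M N) (\<lambda>i \<omega>. (X i \<omega>, Y i \<omega>)) {1..}"
    and identically_distributed: "\<And>i. 1 \<le> i \<Longrightarrow> distr M (borel \<Otimes>\<^sub>M N) (\<lambda>\<omega>. (X i \<omega>, Y i \<omega>))
                       = distr M (borel \<Otimes>\<^sub>M N) (\<lambda>\<omega>. (X0 \<omega>, Y0 \<omega>))"
begin

section \<open>Transfer from the reference pair to the observations\<close>

lemma XY_measurable:
  assumes "1 \<le> i"
  shows "(\<lambda>\<omega>. (X i \<omega>, Y i \<omega>)) \<in> M \<rightarrow>\<^sub>M borel \<Otimes>\<^sub>M N" "X i \<in> M \<rightarrow>\<^sub>M borel" "Y i \<in> M \<rightarrow>\<^sub>M N"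
proof -
  show XY: "(\<lambda>\<omega>. (X i \<omega>, Y i \<omega>)) \<in> M \<rightarrow>\<^sub>M borel \<Otimes>\<^sub>M N"
    using indep assms unfolding indep_vars_def by auto
  show "X i \<in> M \<rightarrow>\<^sub>M borel" "Y i \<in> M \<rightarrow>\<^sub>M N"
    using measurable_compose[OF XY measurable_fst] measurable_compose[OF XY measurable_snd] by simp_all
qed

lemma identically_distributed_compose:
  assumes "1 \<le> i" and f: "f \<in> borel \<Otimes>\<^sub>M N \<rightarrow>\<^sub>M A"
  shows "distr M A (\<lambda>\<omega>. f (X i \<omega>, Y i \<omega>)) = distr M A (\<lambda>\<omega>. f (X0 \<omega>, Y0 \<omega>))"
proof -
  have "distr M A (\<lambda>\<omega>. f (X i \<omega>, Y i \<omega>)) = distr (distr M (borel \<Otimes>\<^sub>M N) (\<lambda>\<omega>. (X i \<omega>, Y i \<omega>))) A f"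
    using XY_measurable(1)[OF assms(1)] f by (subst distr_distr) (simp_all add: comp_def)
  also have "\<dots> = distr M A (\<lambda>\<omega>. f (X0 \<omega>, Y0 \<omega>))"
    unfolding identically_distributed[OF assms(1)] using f by (subst distr_distr) (simp_all add: comp_def)
  finally show ?thesis .
qed

lemma identically_distributed_integral:
  fixes f :: "'c \<times> 'r \<Rightarrow> real"
  assumes "1 \<le> i" and f: "f \<in> borel_measurable (borel \<Otimes>\<^sub>M N)"
  shows "integrable M (\<lambda>\<omega>. f (X i \<omega>, Y i \<omega>)) \<longleftrightarrow> integrable M (\<lambda>\<omega>. f (X0 \<omega>, Y0 \<omega>))"
    and "expectation (\<lambda>\<omega>. f (X i \<omega>, Y i \<omega>)) = expectation (\<lambda>\<omega>. f (X0 \<omega>, Y0 \<omega>))"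
proof -
  have XY0: "(\<lambda>\<omega>. (X0 \<omega>, Y0 \<omega>)) \<in> M \<rightarrow>\<^sub>M borel \<Otimes>\<^sub>M N" by measurable
  note XYi = XY_measurable(1)[OF assms(1)]
  show "integrable M (\<lambda>\<omega>. f (X i \<omega>, Y i \<omega>)) \<longleftrightarrow> integrable M (\<lambda>\<omega>. f (X0 \<omega>, Y0 \<omega>))"
    by (simp only: integrable_distr_eq[OF XYi f, symmetric] integrable_distr_eq[OF XY0 f, symmetric]
        identically_distributed[OF assms(1)])
  show "expectation (\<lambda>\<omega>. f (X i \<omega>, Y i \<omega>)) = expectation (\<lambda>\<omega>. f (X0 \<omega>, Y0 \<omega>))"
    by (simp only: integral_distr[OF XYi f, symmetric] integral_distr[OF XY0 f, symmetric]
        identically_distributed[OF assms(1)])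
qed

lemma indep_compose:
  assumes f: "f \<in> borel \<Otimes>\<^sub>M N \<rightarrow>\<^sub>M A"
  shows "indep_vars (\<lambda>_. A) (\<lambda>i \<omega>. f (X i \<omega>, Y i \<omega>)) {1..n}"
  by (rule indep_vars_compose2[OF indep_vars_subset[OF indep]]) (use f in auto)

section \<open>Numerator and denominator of the estimator error\<close>

definition weighted_sum :: "real \<Rightarrow> nat \<Rightarrow> 'w \<Rightarrow> 'b" where
  "weighted_sum r n \<omega> = (\<Sum>i=1..n. summand r (X i \<omega>, Y i \<omega>))"

definition total_weight :: "real \<Rightarrow> nat \<Rightarrow> 'w \<Rightarrow> real" where
  "total_weight r n \<omega> = (\<Sum>i=1..n. kernel_weight K x r (X i \<omega>))"

lemma weight_measurable:
  assumes "0 < r" "1 \<le> i"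
  shows "(\<lambda>\<omega>. kernel_weight K x r (X i \<omega>)) \<in> borel_measurable M"
  using XY_measurable(2)[OF assms(2)] kernel_weight_measurable[OF assms(1)] by (rule measurable_compose)

lemma weighted_sum_measurable: "0 < r \<Longrightarrow> weighted_sum r n \<in> borel_measurable M"
  unfolding weighted_sum_def
  by (intro borel_measurable_sum measurable_compose[OF XY_measurable(1) summand_measurable]) auto

lemma total_weight_measurable: "0 < r \<Longrightarrow> total_weight r n \<in> borel_measurable M"
  unfolding total_weight_def by (intro borel_measurable_sum weight_measurable) auto

lemma error_measurable:
  assumes r: "0 < r"
  shows "(\<lambda>\<omega>. bias_term L F K x r n (\<lambda>i. X i \<omega>) + noise_term L G \<kappa> K x r n (\<lambda>i. X i \<omega>) (\<lambda>i. Y i \<omega>))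
    \<in> borel_measurable M"
proof -
  have L: "blinfun_apply L \<in> borel_measurable borel"
    by (intro borel_measurable_continuous_onI continuous_intros)
  have avg: "(\<lambda>\<omega>. kernel_average K x r n (\<lambda>i. X i \<omega>) (\<lambda>i. f i \<omega>)) \<in> borel_measurable M"
    if "\<And>i. 1 \<le> i \<Longrightarrow> f i \<in> borel_measurable M" for f :: "nat \<Rightarrow> 'w \<Rightarrow> 'g"
    unfolding kernel_average_def
    by (intro borel_measurable_scaleR borel_measurable_inverse borel_measurable_sum
        weight_measurable[OF r] that) auto
  have Fm: "(\<lambda>\<omega>. F (X i \<omega>)) \<in> borel_measurable M" if "1 \<le> i" for i
    using XY_measurable(2)[OF that] F by (rule measurable_compose)
  have Gm: "(\<lambda>\<omega>. G (Y i \<omega>) - (\<integral>y. G y \<partial>\<kappa> (X i \<omega>))) \<in> borel_measurable M" if "1 \<le> i" for i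
    using measurable_compose[OF XY_measurable(3)[OF that] G]
      measurable_compose[OF XY_measurable(2)[OF that] cond_mean_measurable]
    by (simp add: cond_mean_def)
  have "(\<lambda>\<omega>. kernel_average K x r n (\<lambda>i. X i \<omega>) (\<lambda>i. F (X i \<omega>)) - F x) \<in> borel_measurable M"
    by (intro borel_measurable_diff avg Fm) auto
  then show ?thesis
    unfolding bias_term_def noise_term_def
    by (intro borel_measurable_add measurable_compose[OF _ L] avg Gm)
qed

text \<open>For a nonzero denominator the normalised weights sum to 1, so \<open>F x\<close> can be
  moved inside the sum; for denominator 0 the bias term would be \<open>L (- F x)\<close>
  instead.\<close>

lemma error_eq_quotient:
  assumes "total_weight r n \<omega> \<noteq> 0"
  shows "bias_term L F K x r n (\<lambda>i. X i \<omega>) + noise_term L G \<kappa> K x r n (\<lambda>i. X i \<omega>) (\<lambda>i. Y i \<omega>)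
    = weighted_sum r n \<omega> /\<^sub>R total_weight r n \<omega>"
proof -
  define D where "D = total_weight r n \<omega>"
  define w where "w i = kernel_weight K x r (X i \<omega>)" for i
  have D: "D \<noteq> 0" "D = (\<Sum>i=1..n. w i)" using assms by (simp_all add: D_def total_weight_def w_def)
  have "kernel_average K x r n (\<lambda>i. X i \<omega>) (\<lambda>i. F (X i \<omega>)) - F x
      = ((\<Sum>i=1..n. w i *\<^sub>R F (X i \<omega>)) - D *\<^sub>R F x) /\<^sub>R D"
    using D by (simp add: kernel_average_def w_def scaleR_diff_right)
  also have "(\<Sum>i=1..n. w i *\<^sub>R F (X i \<omega>)) - D *\<^sub>R F x = (\<Sum>i=1..n. w i *\<^sub>R (F (X i \<omega>) - F x))"
    by (simp add: D(2) scaleR_sum_left scaleR_diff_right sum_subtractf)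
  finally have "bias_term L F K x r n (\<lambda>i. X i \<omega>) + noise_term L G \<kappa> K x r n (\<lambda>i. X i \<omega>) (\<lambda>i. Y i \<omega>)
      = L ((\<Sum>i=1..n. w i *\<^sub>R (F (X i \<omega>) - F x)) /\<^sub>R D
          + (\<Sum>i=1..n. w i *\<^sub>R (G (Y i \<omega>) - cond_mean (X i \<omega>))) /\<^sub>R D)"
    unfolding bias_term_def noise_term_def blinfun.add_right
    by (simp add: kernel_average_def w_def[symmetric] D(2) cond_mean_def)
  also have "\<dots> = L ((\<Sum>i=1..n. w i *\<^sub>R (F (X i \<omega>) - F x + (G (Y i \<omega>) - cond_mean (X i \<omega>)))) /\<^sub>R D)"
    by (simp only: scaleR_add_right sum.distrib)
  also have "\<dots> = weighted_sum r n \<omega> /\<^sub>R D"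
    unfolding weighted_sum_def summand_def by (simp add: blinfun.scaleR_right blinfun.sum_right w_def)
  finally show ?thesis by (simp add: D_def)
qed

lemma norm_error_ge:
  assumes r: "0 < r" and pos: "0 < a" "0 < t" "0 < A"
    and S: "a * t \<le> norm (weighted_sum r n \<omega>)" and D: "total_weight r n \<omega> < A * t"
  shows "a / A \<le> norm (bias_term L F K x r n (\<lambda>i. X i \<omega>)
    + noise_term L G \<kappa> K x r n (\<lambda>i. X i \<omega>) (\<lambda>i. Y i \<omega>))"
proof -
  have nonneg: "0 \<le> kernel_weight K x r (X i \<omega>)" for i
    by (rule kernel_weight_bounds(3)[OF r])
  \<comment> \<open>The convention for zero denominators does no harm: nonnegative weights with sum
    0 all vanish, and then the numerator would be 0 as well, against its lower bound.\<close>
  have "total_weight r n \<omega> \<noteq> 0"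
  proof
    assume "total_weight r n \<omega> = 0"
    then have "\<forall>i\<in>{1..n}. kernel_weight K x r (X i \<omega>) = 0"
      unfolding total_weight_def using nonneg by (subst (asm) sum_nonneg_eq_0_iff) auto
    then have "weighted_sum r n \<omega> = 0"
      unfolding weighted_sum_def summand_def by (intro sum.neutral) simp
    then show False using S mult_pos_pos[OF pos(1,2)] by simp
  qed
  moreover have "0 \<le> total_weight r n \<omega>" unfolding total_weight_def by (intro sum_nonneg nonneg)
  ultimately have D0: "0 < total_weight r n \<omega>" by simp
  have "a / A * total_weight r n \<omega> \<le> a / A * (A * t)" using D pos by (intro mult_left_mono) auto
  also have "\<dots> \<le> norm (weighted_sum r n \<omega>)" using S pos by simp
  finally have "a / A \<le> norm (weighted_sum r n \<omega>) / total_weight r n \<omega>"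
    using D0 by (simp only: pos_le_divide_eq)
  also have "\<dots> = norm (weighted_sum r n \<omega> /\<^sub>R total_weight r n \<omega>)"
    using D0 by (simp add: divide_inverse mult.commute)
  finally show ?thesis using error_eq_quotient D0 by simp
qed

lemma prob_total_weight_ge:
  assumes r: "0 < r" and pos: "0 < real n * small_ball M X0 x r" and A: "0 < A"
  shows "prob {\<omega>\<in>space M. A * (real n * small_ball M X0 x r) \<le> total_weight r n \<omega>} \<le> L_K / A"
proof -
  note [measurable] = kernel_weight_measurable[OF r]
  define s where "s = real n * small_ball M X0 x r"
  have eq: "integrable M (\<lambda>\<omega>. kernel_weight K x r (X i \<omega>))"
    "expectation (\<lambda>\<omega>. kernel_weight K x r (X i \<omega>)) = expectation (\<lambda>\<omega>. kernel_weight K x r (X0 \<omega>))"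
    if "1 \<le> i" for i
    using identically_distributed_integral[OF that, of "\<lambda>v. kernel_weight K x r (fst v)"]
      kernel_weight_expectation(1)[OF r] by simp_all
  have int: "integrable M (total_weight r n)" unfolding total_weight_def using eq by auto
  have "expectation (total_weight r n) = real n * expectation (\<lambda>\<omega>. kernel_weight K x r (X0 \<omega>))"
    unfolding total_weight_def using eq by (subst Bochner_Integration.integral_sum) auto
  also have "\<dots> \<le> L_K * s"
    using mult_left_mono[OF kernel_weight_expectation(3)[OF r], of "real n"] by (simp add: s_def mult_ac)
  finally have E: "expectation (total_weight r n) \<le> L_K * s" .
  have "prob {\<omega>\<in>space M. A * s \<le> total_weight r n \<omega>} \<le> expectation (total_weight r n) / (A * s)"
  proof (rule integral_Markov_inequality_measure[where A = "{}"])
    show "AE \<omega> in M. 0 \<le> total_weight r n \<omega>"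
      unfolding total_weight_def using kernel_weight_bounds(3)[OF r] by (auto intro!: sum_nonneg)
  qed (use pos A int in \<open>auto simp: s_def\<close>)
  also have "\<dots> \<le> L_K * s / (A * s)" using E pos A by (intro divide_right_mono) (auto simp: s_def)
  also have "\<dots> = L_K / A" using less_imp_neq[OF pos] by (simp add: s_def)
  finally show ?thesis by (simp add: s_def)
qed

text \<open>All constants are fixed before \<open>n\<close>, and the regime is decided for each
  \<open>n\<close> separately, so the ratio of the two rates need not converge.\<close>

lemma norm_weighted_sum_lower_bound:
  fixes h :: "nat \<Rightarrow> real" and \<psi> :: "nat \<Rightarrow> 'b \<Rightarrow>\<^sub>L real"
  defines "s \<equiv> \<lambda>n. real n * small_ball M X0 x (h n)"
  assumes type_2: "type_2 TYPE('b)" and coord: "coordinate_functionals d e \<psi>"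
    and h: "\<And>n. 0 < h n" "h \<longlonglongrightarrow> 0" "filterlim s at_top sequentially"
    and \<beta>: "0 < \<beta>" and b_F: "0 < b_F" and C: "0 \<le> C" and \<nu>: "2 < \<nu>" and \<sigma>: "0 < \<sigma>" and r0: "0 < r0"
    and F_near: "\<And>z. dist x z < r0 \<Longrightarrow> norm (F z - F x) \<le> b_F * dist x z powr \<beta>"
    and G_near: "\<And>z. dist x z < r0 \<Longrightarrow> integrable (\<kappa> z) G"
    and moment_near: "\<And>z. dist x z < r0 \<Longrightarrow>
      (\<integral>\<^sup>+y. ennreal (norm (G y - cond_mean z) powr \<nu>) \<partial>\<kappa> z) \<le> ennreal C"
    and variance_near: "\<And>z. dist x z < r0 \<Longrightarrow> \<sigma> \<le> cond_coord_variance (\<psi> i0) L G \<kappa> z"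
    and b1: "0 < b1" "\<forall>\<^sub>F n in sequentially. b1 < h n powr (- \<beta>) * norm (mean_bias M X0 L F K x (h n))"
  obtains c q where "0 < c" "0 < q"
    "\<forall>\<^sub>F n in sequentially. q \<le>
      prob {\<omega>\<in>space M. c * (max (h n powr \<beta>) (s n powr (- 1 / 2)) * s n) \<le> norm (weighted_sum (h n) n \<omega>)}"
proof -
  \<comment> \<open>At most 3 for the expansion of the characteristic function, at most
    \<open>\<nu>\<close> for the available moments.\<close>
  define p where "p = min \<nu> 3"
  have p: "2 < p" "p \<le> 3" "p \<le> \<nu>" using \<nu> by (auto simp: p_def)
  \<comment> \<open>The value of \<open>moment_const\<close> for \<open>b = b_F\<close>; at
    distances up to 1 the Hoelder bound is at most \<open>b_F\<close>.\<close>
  define J where "J q = (2 * (L_K * norm L)) powr q * (b_F powr q + 1 + C)" for q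
  have J0: "0 \<le> J q" for q using C by (simp add: J_def)
  \<comment> \<open>Adding 1 allows division by \<open>\<Psi>\<close> without a separate proof that
    the functional is nonzero.\<close>
  define \<Psi> where "\<Psi> = norm (\<psi> i0) + 1"
  have \<Psi>: "1 \<le> \<Psi>" by (simp add: \<Psi>_def)
  define J1 where "J1 = norm (\<psi> i0) * J 1 + (norm (\<psi> i0))\<^sup>2 * J 2 + norm (\<psi> i0) powr p * J p"
  have J1: "0 \<le> J1" "norm (\<psi> i0) * J 1 \<le> J1" "(norm (\<psi> i0))\<^sup>2 * J 2 \<le> J1" "norm (\<psi> i0) powr p * J p \<le> J1"
    using J0 by (simp_all add: J1_def)
  have \<sigma>': "0 < l_K\<^sup>2 * \<sigma>" using \<sigma> kernel_bounds by simp
  obtain c1 q1 S0 where c1: "0 < c1" "0 < q1" and anti: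
    "\<And>(n::nat) (\<phi>::real) (V :: nat \<Rightarrow> 'w \<Rightarrow> real) V0. indep_vars (\<lambda>_. borel) V {1..n} \<Longrightarrow>
      (\<And>i. i \<in> {1..n} \<Longrightarrow> distr M borel (V i) = distr M borel V0) \<Longrightarrow>
      V0 \<in> borel_measurable M \<Longrightarrow> integrable M (\<lambda>\<omega>. (V0 \<omega>)\<^sup>2) \<Longrightarrow>
      integrable M (\<lambda>\<omega>. \<bar>V0 \<omega>\<bar> powr p) \<Longrightarrow> 0 < \<phi> \<Longrightarrow> \<phi> \<le> 1 \<Longrightarrow> S0 \<le> n * \<phi> \<Longrightarrow>
      expectation (\<lambda>\<omega>. \<bar>V0 \<omega>\<bar>) \<le> J1 * \<phi> \<Longrightarrow> expectation (\<lambda>\<omega>. (V0 \<omega>)\<^sup>2) \<le> J1 * \<phi> \<Longrightarrow>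
      expectation (\<lambda>\<omega>. \<bar>V0 \<omega>\<bar> powr p) \<le> J1 * \<phi> \<Longrightarrow> l_K\<^sup>2 * \<sigma> * \<phi> \<le> variance V0 \<Longrightarrow>
      q1 \<le> prob {\<omega>\<in>space M. c1 * sqrt (n * \<phi>) \<le> \<bar>\<Sum>i=1..n. V i \<omega>\<bar>}"
    using prob_abs_sum_ge_uniform[OF \<sigma>' J1(1) p(1,2)] by blast
  have J12: "0 \<le> J 1 + J 2" using J0 by simp
  obtain A where A: "0 < A" and conc:
    "\<And>(n::nat) (\<phi>::real) (W :: nat \<Rightarrow> 'w \<Rightarrow> 'b) W0. indep_vars (\<lambda>_. borel) W {1..n} \<Longrightarrow>
      (\<And>i. i \<in> {1..n} \<Longrightarrow> distr M borel (W i) = distr M borel W0) \<Longrightarrow>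
      W0 \<in> borel_measurable M \<Longrightarrow> integrable M (\<lambda>\<omega>. (norm (W0 \<omega>))\<^sup>2) \<Longrightarrow>
      0 < \<phi> \<Longrightarrow> \<phi> \<le> 1 \<Longrightarrow> 1 \<le> n \<Longrightarrow>
      expectation (\<lambda>\<omega>. norm (W0 \<omega>)) \<le> (J 1 + J 2) * \<phi> \<Longrightarrow>
      expectation (\<lambda>\<omega>. (norm (W0 \<omega>))\<^sup>2) \<le> (J 1 + J 2) * \<phi> \<Longrightarrow>
      prob {\<omega>\<in>space M. A * sqrt (n * \<phi>) \<le> norm ((\<Sum>i=1..n. W i \<omega>) - real n *\<^sub>R expectation W0)} \<le> 1 / 2"
    using prob_norm_centred_sum_ge[OF type_2 J12] by blast
  \<comment> \<open>\<open>B * h n powr \<beta> * s n\<close> will bound the norm of the mean of the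
    sum from below: \<open>l_K\<close> comes from the mean weight, \<open>b1\<close> from the
    bias.\<close>
  define B where "B = l_K * b1"
  have B: "0 < B" using kernel_bounds b1 by (simp add: B_def)
  \<comment> \<open>The threshold at which the fluctuation bound \<open>A * sqrt (s n)\<close> is
    half of the lower bound for the mean.\<close>
  define \<rho> where "\<rho> = 2 * A / B"
  have \<rho>: "0 < \<rho>" using A B by (simp add: \<rho>_def)
  \<comment> \<open>The larger rate is at most \<open>1 + 1 / \<rho>\<close> times
    \<open>h n powr \<beta>\<close> above the threshold and at most \<open>1 + \<rho>\<close> times
    the other rate below it; each entry of the minimum serves one regime.\<close>
  define c where "c = min (B / 2 / (1 + 1 / \<rho>)) (c1 / \<Psi> / (1 + \<rho>))"
  have c: "0 < c" "c * (1 + 1 / \<rho>) \<le> B / 2" "c * (1 + \<rho>) \<le> c1 / \<Psi>"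
  proof -
    have "0 < 1 + 1 / \<rho>" "0 < 1 + \<rho>" using \<rho> by (auto intro: add_pos_pos)
    moreover from this show "0 < c" using B c1 \<Psi> by (simp add: c_def)
    moreover have "c \<le> B / 2 / (1 + 1 / \<rho>)" "c \<le> c1 / \<Psi> / (1 + \<rho>)" by (simp_all add: c_def)
    ultimately show "c * (1 + 1 / \<rho>) \<le> B / 2" "c * (1 + \<rho>) \<le> c1 / \<Psi>"
      by (simp_all only: pos_le_divide_eq)
  qed
  \<comment> \<open>1/2 is what Chebyshev leaves in the bias regime; \<open>q1\<close> belongs to
    the fluctuation regime.\<close>
  define q where "q = min (1 / 2) q1"
  have q: "0 < q" "q \<le> 1 / 2" "q \<le> q1" using c1 by (auto simp: q_def)
  have "\<forall>\<^sub>F n in sequentially. h n < min 1 r0"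
    using r0 by (intro order_tendstoD(2)[OF h(2)]) auto
  moreover have "\<forall>\<^sub>F n in sequentially. max 1 S0 \<le> s n"
    using h(3) unfolding filterlim_at_top by blast
  ultimately have "\<forall>\<^sub>F n in sequentially. q \<le>
      prob {\<omega>\<in>space M. c * (max (h n powr \<beta>) (s n powr (- 1 / 2)) * s n) \<le> norm (weighted_sum (h n) n \<omega>)}"
    using b1(2)
  proof eventually_elim
    case (elim n)
    define r where "r = h n"
    define \<phi> where "\<phi> = small_ball M X0 x r"
    have r: "0 < r" "r < 1" "r < r0" using elim(1) h(1) by (auto simp: r_def)
    have s: "s n = real n * \<phi>" "1 \<le> s n" "S0 \<le> s n" using elim(2) by (simp_all add: s_def \<phi>_def r_def)
    have \<phi>1: "\<phi> \<le> 1" "0 \<le> \<phi>" by (simp_all add: \<phi>_def small_ball_def)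
    have n: "1 \<le> n" using s by (cases n) auto
    have \<phi>0: "0 < \<phi>" using s \<phi>1 by (cases "\<phi> = 0") auto
    \<comment> \<open>The same constants work for every bandwidth below \<open>min 1 r0\<close>, as
      its ball lies within the region of the local assumptions.\<close>
    interpret B: kernel_model_ball M N X0 Y0 \<kappa> x L F G K l_K L_K r b_F C \<nu> \<sigma> "\<psi> i0"
    proof unfold_locales
      show "0 < r" "0 \<le> b_F" "0 \<le> C" "2 < \<nu>" "0 < \<sigma>" using r b_F C \<nu> \<sigma> by auto
      fix z assume "dist x z \<le> r"
      then have z: "dist x z < r0" "dist x z \<le> 1" using r by auto
      have "b_F * dist x z powr \<beta> \<le> b_F * 1 powr \<beta>"
        using z \<beta> b_F by (intro mult_left_mono powr_mono2) auto
      then show "norm (F z - F x) \<le> b_F" using F_near[OF z(1)] by simp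
      show "integrable (\<kappa> z) G" "\<sigma> \<le> cond_coord_variance (\<psi> i0) L G \<kappa> z"
        "(\<integral>\<^sup>+y. ennreal (norm (G y - cond_mean z) powr \<nu>) \<partial>\<kappa> z) \<le> ennreal C"
        using G_near[OF z(1)] variance_near[OF z(1)] moment_near[OF z(1)] by auto
    qed
    have mom: "integrable M (\<lambda>\<omega>. norm (summand r (X0 \<omega>, Y0 \<omega>)) powr u)"
      "expectation (\<lambda>\<omega>. norm (summand r (X0 \<omega>, Y0 \<omega>)) powr u) \<le> J u * \<phi>" if "0 < u" "u \<le> \<nu>" for u
      using B.summand_moment[OF that] by (simp_all add: B.moment_const_def J_def \<phi>_def)
    have m1: "expectation (\<lambda>\<omega>. norm (summand r (X0 \<omega>, Y0 \<omega>))) \<le> J 1 * \<phi>"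
      using mom(2)[of 1] \<nu> by simp
    have m2: "expectation (\<lambda>\<omega>. (norm (summand r (X0 \<omega>, Y0 \<omega>)))\<^sup>2) \<le> J 2 * \<phi>"
      using mom(2)[of 2] \<nu> by (simp add: powr_numeral)
    have inv_sqrt: "s n powr (- 1 / 2) = 1 / sqrt (s n)"
      using s by (simp add: powr_minus_divide powr_half_sqrt)
    have [measurable]: "weighted_sum r n \<in> borel_measurable M" by (rule weighted_sum_measurable[OF r(1)])
    define g where "g = h n powr \<beta>"
    have g: "0 < g" using h(1)[of n] by (simp add: g_def)
    define sq where "sq = sqrt (s n)"
    have sq: "0 < sq" "s n = sq * sq" using s by (simp_all add: sq_def)
    have sq': "1 / sq * s n = sq" using sq by simp
    have \<delta>_eq: "max (h n powr \<beta>) (s n powr (- 1 / 2)) = max g (1 / sq)"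
      unfolding inv_sqrt g_def sq_def ..
    have "q \<le> prob {\<omega>\<in>space M. c * (max g (1 / sq) * s n) \<le> norm (weighted_sum r n \<omega>)}"
    \<comment> \<open>\<open>g * sq\<close> is the ratio of \<open>h n powr \<beta>\<close> to
      \<open>s n powr (- 1 / 2)\<close>.\<close>
    proof (cases "\<rho> \<le> g * sq")
      case True
      define E2 where "E2 = {\<omega>\<in>space M. A * sq \<le> norm (weighted_sum r n \<omega> - real n *\<^sub>R expectation B.W0)}"
      have pE2: "prob E2 \<le> 1 / 2"
      proof -
        have "prob {\<omega>\<in>space M. A * sqrt (n * \<phi>)
            \<le> norm ((\<Sum>i=1..n. summand r (X i \<omega>, Y i \<omega>)) - real n *\<^sub>R expectation B.W0)} \<le> 1 / 2"
        proof (rule conc)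
          show "indep_vars (\<lambda>_. borel) (\<lambda>i \<omega>. summand r (X i \<omega>, Y i \<omega>)) {1..n}"
            by (rule indep_compose) measurable
          show "distr M borel (\<lambda>\<omega>. summand r (X i \<omega>, Y i \<omega>)) = distr M borel B.W0" if "i \<in> {1..n}" for i
            using that by (intro identically_distributed_compose) auto
          have "J 1 * \<phi> \<le> (J 1 + J 2) * \<phi>" "J 2 * \<phi> \<le> (J 1 + J 2) * \<phi>"
            using J0 \<phi>0 by (auto intro!: mult_right_mono)
          then show "expectation (\<lambda>\<omega>. norm (B.W0 \<omega>)) \<le> (J 1 + J 2) * \<phi>"
            "expectation (\<lambda>\<omega>. (norm (B.W0 \<omega>))\<^sup>2) \<le> (J 1 + J 2) * \<phi>"
            using m1 m2 by linarith+
        qed (use \<phi>0 \<phi>1 n B.coord_summand_integrable in auto)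
        then show ?thesis by (simp add: E2_def weighted_sum_def s(1) sq_def)
      qed
      have "b1 * g < norm (mean_bias M X0 L F K x r)"
        using elim(3) h(1)[of n] by (simp add: g_def r_def powr_minus field_simps)
      moreover have "l_K * \<phi> \<le> expectation (\<lambda>\<omega>. kernel_weight K x r (X0 \<omega>))"
        using kernel_weight_expectation(2)[OF r(1)] by (simp add: \<phi>_def)
      ultimately have "real n * ((l_K * \<phi>) * (b1 * g))
          \<le> real n * (expectation (\<lambda>\<omega>. kernel_weight K x r (X0 \<omega>)) * norm (mean_bias M X0 L F K x r))"
        using kernel_bounds \<phi>0 b1 g
        by (intro mult_left_mono mult_mono) (auto intro: order_trans[OF _ \<open>l_K * \<phi> \<le> _\<close>])
      also have "\<dots> = norm (real n *\<^sub>R expectation B.W0)"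
        using B.expectation_summand[OF coord] \<phi>0 kernel_bounds
          order_trans[OF _ \<open>l_K * \<phi> \<le> expectation (\<lambda>\<omega>. kernel_weight K x r (X0 \<omega>))\<close>, of 0]
        by (simp add: \<phi>_def)
      finally have mean: "B * g * s n \<le> norm (real n *\<^sub>R expectation B.W0)"
        by (simp add: s(1) B_def mult_ac)
      have "A * sq = B / 2 * (\<rho> * sq)" using B by (simp add: \<rho>_def)
      also have "\<dots> \<le> B / 2 * (g * sq * sq)" using B True sq by (intro mult_left_mono mult_right_mono) auto
      finally have Asq: "A * sq \<le> B / 2 * g * s n" by (simp add: sq mult_ac)
      have "1 / sq \<le> g * (1 / \<rho>)" using True sq \<rho> by (simp add: field_simps)
      then have "max g (1 / sq) \<le> (1 + 1 / \<rho>) * g"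
        using g \<rho> by (auto simp: distrib_right)
      then have "c * (max g (1 / sq) * s n) \<le> c * ((1 + 1 / \<rho>) * g * s n)"
        using c s by (intro mult_left_mono mult_right_mono) auto
      also have "\<dots> = c * (1 + 1 / \<rho>) * (g * s n)" by simp
      also have "\<dots> \<le> B / 2 * (g * s n)" using c g s by (intro mult_right_mono) auto
      finally have target: "c * (max g (1 / sq) * s n) \<le> B / 2 * g * s n" by simp
      have "prob (space M) - prob E2 \<le>
          prob {\<omega>\<in>space M. c * (max g (1 / sq) * s n) \<le> norm (weighted_sum r n \<omega>)}"
      proof (rule prob_ge_diff)
        show "E2 \<in> events" unfolding E2_def by measurable
        show "{\<omega>\<in>space M. c * (max g (1 / sq) * s n) \<le> norm (weighted_sum r n \<omega>)} \<in> events" by measurable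
        show "space M \<subseteq> E2 \<union> {\<omega>\<in>space M. c * (max g (1 / sq) * s n) \<le> norm (weighted_sum r n \<omega>)}"
        proof (intro subsetI)
          fix \<omega> assume \<omega>: "\<omega> \<in> space M"
          show "\<omega> \<in> E2 \<union> {\<omega>\<in>space M. c * (max g (1 / sq) * s n) \<le> norm (weighted_sum r n \<omega>)}"
          proof (cases "\<omega> \<in> E2")
            case False
            then have "norm (weighted_sum r n \<omega> - real n *\<^sub>R expectation B.W0) < A * sq"
              using \<omega> by (auto simp: E2_def)
            then have "B * g * s n - A * sq \<le> norm (weighted_sum r n \<omega>)"
              using mean norm_triangle_ineq3[of "weighted_sum r n \<omega>" "real n *\<^sub>R expectation B.W0"] by linarith
            then have "B / 2 * g * s n \<le> norm (weighted_sum r n \<omega>)" using Asq by simp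
            then show ?thesis using target \<omega> by auto
          qed simp
        qed
      qed simp
      then show ?thesis using pE2 q unfolding prob_space by linarith
    next
      case False
      \<comment> \<open>A bounded functional enlarges norms by at most the factor
        \<open>\<Psi>\<close>, so a large coordinate of the sum makes the sum itself large.\<close>
      define V where "V = (\<lambda>i \<omega>. \<psi> i0 (summand r (X i \<omega>, Y i \<omega>)))"
      define V0 where "V0 = (\<lambda>\<omega>. \<psi> i0 (B.W0 \<omega>))"
      have V0_le: "\<bar>V0 \<omega>\<bar> \<le> norm (\<psi> i0) * norm (B.W0 \<omega>)" for \<omega>
        using norm_blinfun[of "\<psi> i0" "B.W0 \<omega>"] by (simp add: V0_def)
      have V0p_le: "\<bar>V0 \<omega>\<bar> powr p \<le> norm (\<psi> i0) powr p * norm (B.W0 \<omega>) powr p" for \<omega>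
        using powr_mono2[OF _ _ V0_le, of p] p by (simp add: powr_mult)
      have V02_le: "(V0 \<omega>)\<^sup>2 \<le> (norm (\<psi> i0))\<^sup>2 * (norm (B.W0 \<omega>))\<^sup>2" for \<omega>
        using power_mono[OF V0_le, of \<omega> 2] by (simp add: power_mult_distrib)
      have [measurable]: "V0 \<in> borel_measurable M" unfolding V0_def by measurable
      have V0_int: "integrable M V0" "integrable M (\<lambda>\<omega>. (V0 \<omega>)\<^sup>2)"
        using B.coord_summand_integrable by (simp_all add: V0_def)
      have mp: "integrable M (\<lambda>\<omega>. norm (B.W0 \<omega>) powr p)" using mom(1)[of p] p by simp
      have V0p_int: "integrable M (\<lambda>\<omega>. \<bar>V0 \<omega>\<bar> powr p)"
        by (rule Bochner_Integration.integrable_bound[where f = "\<lambda>\<omega>. norm (\<psi> i0) powr p * norm (B.W0 \<omega>) powr p"])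
          (use mp V0p_le in auto)
      have "q1 \<le> prob {\<omega>\<in>space M. c1 * sqrt (n * \<phi>) \<le> \<bar>\<Sum>i=1..n. V i \<omega>\<bar>}"
      proof (rule anti)
        show "indep_vars (\<lambda>_. borel) V {1..n}"
          unfolding V_def by (rule indep_compose[of "\<lambda>v. \<psi> i0 (summand r v)"]) measurable
        show "distr M borel (V i) = distr M borel V0" if "i \<in> {1..n}" for i
          using that unfolding V_def V0_def
          by (intro identically_distributed_compose[of _ "\<lambda>v. \<psi> i0 (summand r v)"]) auto
        show "integrable M (\<lambda>\<omega>. (V0 \<omega>)\<^sup>2)" "integrable M (\<lambda>\<omega>. \<bar>V0 \<omega>\<bar> powr p)" by fact+
        show "S0 \<le> real n * \<phi>" using s by simp
        show "l_K\<^sup>2 * \<sigma> * \<phi> \<le> variance V0"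
          using B.coord_summand_variance by (simp add: V0_def \<phi>_def)
        have "expectation (\<lambda>\<omega>. \<bar>V0 \<omega>\<bar>) \<le> expectation (\<lambda>\<omega>. norm (\<psi> i0) * norm (B.W0 \<omega>))"
          using V0_int B.coord_summand_integrable V0_le by (intro integral_mono) auto
        also have "\<dots> \<le> norm (\<psi> i0) * (J 1 * \<phi>)" using m1 by (simp add: mult_left_mono)
        also have "\<dots> \<le> J1 * \<phi>" using mult_right_mono[OF J1(2), of \<phi>] \<phi>0 by (simp add: mult.assoc)
        finally show "expectation (\<lambda>\<omega>. \<bar>V0 \<omega>\<bar>) \<le> J1 * \<phi>" .
        have "expectation (\<lambda>\<omega>. (V0 \<omega>)\<^sup>2) \<le> expectation (\<lambda>\<omega>. (norm (\<psi> i0))\<^sup>2 * (norm (B.W0 \<omega>))\<^sup>2)"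
          using V0_int B.coord_summand_integrable V02_le by (intro integral_mono) auto
        also have "\<dots> \<le> (norm (\<psi> i0))\<^sup>2 * (J 2 * \<phi>)" using m2 by (simp add: mult_left_mono)
        also have "\<dots> \<le> J1 * \<phi>" using mult_right_mono[OF J1(3), of \<phi>] \<phi>0 by (simp add: mult.assoc)
        finally show "expectation (\<lambda>\<omega>. (V0 \<omega>)\<^sup>2) \<le> J1 * \<phi>" .
        have "expectation (\<lambda>\<omega>. \<bar>V0 \<omega>\<bar> powr p) \<le> expectation (\<lambda>\<omega>. norm (\<psi> i0) powr p * norm (B.W0 \<omega>) powr p)"
          using V0p_int mp V0p_le by (intro integral_mono) auto
        also have "\<dots> \<le> norm (\<psi> i0) powr p * (J p * \<phi>)" using mom(2)[of p] p by (simp add: mult_left_mono)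
        also have "\<dots> \<le> J1 * \<phi>" using mult_right_mono[OF J1(4), of \<phi>] \<phi>0 by (simp add: mult.assoc)
        finally show "expectation (\<lambda>\<omega>. \<bar>V0 \<omega>\<bar> powr p) \<le> J1 * \<phi>" .
      qed (use \<phi>0 \<phi>1 in auto)
      also have "\<dots> \<le> prob {\<omega>\<in>space M. c * (max g (1 / sq) * s n) \<le> norm (weighted_sum r n \<omega>)}"
      proof (rule finite_measure_mono)
        show "{\<omega>\<in>space M. c * (max g (1 / sq) * s n) \<le> norm (weighted_sum r n \<omega>)} \<in> events" by measurable
        have "g \<le> \<rho> * (1 / sq)" using False sq by (simp add: field_simps)
        moreover have "0 < \<rho> * (1 / sq)" "0 < 1 / sq" using \<rho> sq by simp_all
        ultimately have "max g (1 / sq) \<le> (1 + \<rho>) * (1 / sq)" unfolding distrib_right by linarith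
        then have "c * (max g (1 / sq) * s n) \<le> c * ((1 + \<rho>) * (1 / sq) * s n)"
          using c s by (intro mult_left_mono mult_right_mono) auto
        also have "\<dots> = c * (1 + \<rho>) * sq" unfolding mult.assoc sq' ..
        also have "\<dots> \<le> c1 / \<Psi> * sq" using c sq by (intro mult_right_mono) auto
        finally have target: "c * (max g (1 / sq) * s n) \<le> c1 / \<Psi> * sq" .
        show "{\<omega>\<in>space M. c1 * sqrt (real n * \<phi>) \<le> \<bar>\<Sum>i=1..n. V i \<omega>\<bar>}
            \<subseteq> {\<omega>\<in>space M. c * (max g (1 / sq) * s n) \<le> norm (weighted_sum r n \<omega>)}"
        proof safe
          fix \<omega> assume "c1 * sqrt (real n * \<phi>) \<le> \<bar>\<Sum>i=1..n. V i \<omega>\<bar>"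
          then have "c1 * sq \<le> norm (\<psi> i0 (weighted_sum r n \<omega>))"
            by (simp add: V_def weighted_sum_def blinfun.sum_right s(1) sq_def)
          also have "\<dots> \<le> norm (\<psi> i0) * norm (weighted_sum r n \<omega>)" by (rule norm_blinfun)
          also have "\<dots> \<le> \<Psi> * norm (weighted_sum r n \<omega>)" by (intro mult_right_mono) (auto simp: \<Psi>_def)
          finally have "c1 / \<Psi> * sq \<le> norm (weighted_sum r n \<omega>)" using \<Psi> by (simp add: field_simps)
          then show "c * (max g (1 / sq) * s n) \<le> norm (weighted_sum r n \<omega>)" using target by linarith
        qed
      qed
      finally show ?thesis using q by linarith
    qed
    then show ?case unfolding \<delta>_eq r_def .
  qed
  then show thesis using that c q by blast
qed

end

section \<open>Combination of the estimates\<close>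

theorem theorem7:
  fixes M :: "'w measure"
    and N :: "'r measure"
    and X0 :: "'w \<Rightarrow> 'c::polish_space" and Y0 :: "'w \<Rightarrow> 'r"
    and X :: "nat \<Rightarrow> 'w \<Rightarrow> 'c" and Y :: "nat \<Rightarrow> 'w \<Rightarrow> 'r"
    and \<kappa> :: "'c \<Rightarrow> 'r measure"
    and x :: 'c
    and d :: enat and e :: "nat \<Rightarrow> 'b::{banach, second_countable_topology}"
    and \<psi> :: "nat \<Rightarrow> 'b \<Rightarrow>\<^sub>L real"
    and L :: "'g::{banach, second_countable_topology} \<Rightarrow>\<^sub>L 'b"
    and F :: "'c \<Rightarrow> 'g" and G :: "'r \<Rightarrow> 'g"
    and \<Theta> :: "'r measure \<Rightarrow> 'b"
    and K :: "real \<Rightarrow> real" and h :: "nat \<Rightarrow> real"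
    and R :: "nat \<Rightarrow> 'w \<Rightarrow> 'b"
    and C1 C2 C3 C4 t1 t2 t3 t4 l_K L_K \<beta> b_F \<nu> :: real and i0 :: nat
  assumes prob: "prob_space M"
    and XY_measurable: "X0 \<in> M \<rightarrow>\<^sub>M borel" "Y0 \<in> M \<rightarrow>\<^sub>M N"
    and indep: "prob_space.indep_vars M (\<lambda>_. borel \<Otimes>\<^sub>M N) (\<lambda>i \<omega>. (X i \<omega>, Y i \<omega>)) {1..}"
    and identically_distributed: "\<And>i. 1 \<le> i \<Longrightarrow> distr M (borel \<Otimes>\<^sub>M N) (\<lambda>\<omega>. (X i \<omega>, Y i \<omega>))
                       = distr M (borel \<Otimes>\<^sub>M N) (\<lambda>\<omega>. (X0 \<omega>, Y0 \<omega>))"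
    and cond_distr: "regular_cond_distr M X0 Y0 N \<kappa>"
    and type_2: "type_2 TYPE('b)"
    and basis: "schauder_basis d e" "coordinate_functionals d e \<psi>"
    and FG_measurable: "F \<in> borel_measurable borel" "G \<in> borel_measurable N"
    and kernel: "K \<in> borel_measurable (restrict_space borel {0..})" "\<And>u. 0 \<le> u \<Longrightarrow> 0 \<le> K u"
    and constants: "C1 > 0" "C2 > 0" "C3 > 0" "C4 > 0" "t1 \<ge> 0" "t2 \<ge> 0" "t3 \<ge> 0" "t4 \<ge> 0"
    and small_ball_bounds: "\<forall>\<^sub>F r in at_right 0.
           C1 * r powr t1 * exp (- ball_exponent C2 t2 t3 r) \<le> small_ball M X0 x r \<and>
           small_ball M X0 x r \<le> C3 * r powr t4 * exp (- ball_exponent C4 t2 t3 r)"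
    and exponents: "t2 > 0 \<or> (t3 > 1 \<and> C2 = C4)"
    and kernel_bounds: "0 < l_K" "l_K \<le> L_K"
      "\<And>u. 0 \<le> u \<Longrightarrow> u \<le> 1 \<Longrightarrow> l_K \<le> K u \<and> K u \<le> L_K" "\<And>u. 1 < u \<Longrightarrow> K u = 0"
    and bandwidth: "\<And>n. 0 < h n" "h \<longlonglongrightarrow> 0"
      "filterlim (\<lambda>n. real n * small_ball M X0 x (h n)) at_top sequentially"
    and Hoelder: "\<beta> > 0" "b_F > 0"
      "\<forall>\<^sub>F z in nhds x. norm (F z - F x) \<le> b_F * dist x z powr \<beta>"
    and moments: "\<nu> > 2"
      "\<exists>C. \<forall>\<^sub>F z in nhds x. integrable (\<kappa> z) G \<and>
           (\<integral>\<^sup>+y. ennreal (norm (G y - (\<integral>y'. G y' \<partial>\<kappa> z)) powr \<nu>) \<partial>\<kappa> z) \<le> ennreal C"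
    and expansion: "\<And>n \<omega>. \<omega> \<in> space M \<Longrightarrow>
           \<Theta> (weighted_empirical N K x (h n) n (\<lambda>i. X i \<omega>) (\<lambda>i. Y i \<omega>)) - \<Theta> (\<kappa> x)
             = bias_term L F K x (h n) n (\<lambda>i. X i \<omega>)
               + noise_term L G \<kappa> K x (h n) n (\<lambda>i. X i \<omega>) (\<lambda>i. Y i \<omega>) + R n \<omega>"
    and remainder: "little_o_prob M R
           (\<lambda>n. max (h n powr \<beta>) ((real n * small_ball M X0 x (h n)) powr (- 1 / 2)))"
    and bias_lower_bound: "\<exists>b1>0. \<forall>h'. (\<forall>n. 0 < h' n) \<and> h' \<longlonglongrightarrow> 0 \<and>
           filterlim (\<lambda>n. real n * small_ball M X0 x (h' n)) at_top sequentially \<longrightarrow>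
           (\<forall>\<^sub>F n in sequentially. h' n powr (- \<beta>) * norm (mean_bias M X0 L F K x (h' n)) > b1)"
    and variance: "i0 \<in> basis_index d"
      "(cond_coord_variance (\<psi> i0) L G \<kappa> \<longlongrightarrow> cond_coord_variance (\<psi> i0) L G \<kappa> x) (at x)"
      "cond_coord_variance (\<psi> i0) L G \<kappa> x > 0"
  shows "\<exists>c>0. liminf (\<lambda>n. ereal (measure M {\<omega>\<in>space M.
           ball_exponent_inv C2 t2 t3 (ln (real n)) powr (- \<beta>) *
             norm (\<Theta> (weighted_empirical N K x (h n) n (\<lambda>i. X i \<omega>) (\<lambda>i. Y i \<omega>)) - \<Theta> (\<kappa> x))
           > c})) > 0"
proof -
  interpret prob_space M by (rule prob)
  interpret kernel_sample M N X0 Y0 \<kappa> x L F G K l_K L_K X Y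
    by unfold_locales (use XY_measurable cond_distr FG_measurable kernel kernel_bounds indep identically_distributed in auto)
  define V where "V = cond_coord_variance (\<psi> i0) L G \<kappa>"
  \<comment> \<open>Half of the limit: near \<open>x\<close> the conditional variance stays above
    it.\<close>
  define \<sigma> where "\<sigma> = V x / 2"
  have \<sigma>: "0 < \<sigma>" "\<sigma> < V x" using variance(3) by (simp_all add: \<sigma>_def V_def)
  obtain C where C: "\<forall>\<^sub>F z in nhds x. integrable (\<kappa> z) G \<and>
           (\<integral>\<^sup>+y. ennreal (norm (G y - (\<integral>y'. G y' \<partial>\<kappa> z)) powr \<nu>) \<partial>\<kappa> z) \<le> ennreal C"
    using moments(2) by blast
  \<comment> \<open>The limit concerns punctured neighbourhoods; at \<open>x\<close> itself the
    inequality is \<open>\<sigma> < V x\<close>.\<close>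
  have "\<forall>\<^sub>F z in nhds x. \<sigma> < V z"
    using order_tendstoD(1)[OF variance(2)[folded V_def] \<sigma>(2)] \<sigma>(2) by (simp add: eventually_nhds_conv_at)
  then have "\<forall>\<^sub>F z in nhds x. (norm (F z - F x) \<le> b_F * dist x z powr \<beta>) \<and> (integrable (\<kappa> z) G \<and>
      (\<integral>\<^sup>+y. ennreal (norm (G y - (\<integral>y'. G y' \<partial>\<kappa> z)) powr \<nu>) \<partial>\<kappa> z) \<le> ennreal C) \<and> \<sigma> < V z"
    by (rule eventually_conj[OF Hoelder(3) eventually_conj[OF C]])
  then obtain r0 where r0: "0 < r0" and near: "\<And>z. dist z x < r0 \<Longrightarrow>
      (norm (F z - F x) \<le> b_F * dist x z powr \<beta>) \<and> (integrable (\<kappa> z) G \<and>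
      (\<integral>\<^sup>+y. ennreal (norm (G y - (\<integral>y'. G y' \<partial>\<kappa> z)) powr \<nu>) \<partial>\<kappa> z) \<le> ennreal C) \<and> \<sigma> < V z"
    unfolding eventually_nhds_metric by blast
  obtain b1 where b1: "0 < b1"
    "\<forall>\<^sub>F n in sequentially. b1 < h n powr (- \<beta>) * norm (mean_bias M X0 L F K x (h n))"
    using bias_lower_bound bandwidth by blast
  define s where "s n = real n * small_ball M X0 x (h n)" for n
  define \<delta> where "\<delta> n = max (h n powr \<beta>) (s n powr (- 1 / 2))" for n
  obtain c q where c: "0 < c" "0 < q" and sum_lower:
    "\<forall>\<^sub>F n in sequentially. q \<le> prob {\<omega>\<in>space M. c * (\<delta> n * s n) \<le> norm (weighted_sum (h n) n \<omega>)}"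
  \<comment> \<open>The real number \<open>C\<close> might be negative, whereas the lemma asks for a
    nonnegative bound; \<open>ennreal\<close> maps negative numbers to 0, so \<open>max C 0\<close>
    is equally good.\<close>
  proof (rule norm_weighted_sum_lower_bound[OF type_2 basis(2) bandwidth Hoelder(1,2), of "max C 0" \<nu> \<sigma> r0 i0 b1])
    fix z assume "dist x z < r0"
    then have z: "dist z x < r0" by (simp add: dist_commute)
    show "norm (F z - F x) \<le> b_F * dist x z powr \<beta>" "integrable (\<kappa> z) G"
      "\<sigma> \<le> cond_coord_variance (\<psi> i0) L G \<kappa> z"
      using near[OF z] by (auto simp: V_def)
    show "(\<integral>\<^sup>+y. ennreal (norm (G y - cond_mean z) powr \<nu>) \<partial>\<kappa> z) \<le> ennreal (max C 0)"
      using near[OF z] by (auto simp: cond_mean_def intro: order_trans[OF _ ennreal_leI])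
  next
    fix c q :: real
    assume "0 < c" "0 < q" "\<forall>\<^sub>F n in sequentially. q \<le> prob {\<omega>\<in>space M.
      c * (max (h n powr \<beta>) ((real n * small_ball M X0 x (h n)) powr (- 1 / 2)) *
        (real n * small_ball M X0 x (h n))) \<le> norm (weighted_sum (h n) n \<omega>)}"
    then show thesis by (intro that) (simp_all only: s_def \<delta>_def)
  qed (use moments(1) \<sigma> r0 b1 in simp_all)
  obtain a where a: "0 < a" and bandwidth_lower: "\<forall>\<^sub>F n in sequentially.
      0 < ball_exponent_inv C2 t2 t3 (ln (real n)) \<and> a * ball_exponent_inv C2 t2 t3 (ln (real n)) \<le> h n"
  proof -
    have "\<forall>\<^sub>F r in at_right 0. small_ball M X0 x r \<le> C3 * r powr t4 * exp (- ball_exponent C4 t2 t3 r)"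
      using small_ball_bounds by eventually_elim simp
    then show thesis
      using bandwidth_ge_ball_exponent_inv[OF constants(2,3,4,6,7,8) exponents _ bandwidth] that by blast
  qed
  \<comment> \<open>Makes the probability bound \<open>L_K / A\<close> for a large denominator equal
    to \<open>q / 4\<close>.\<close>
  define A where "A = 4 * L_K / q"
  have A: "0 < A" "L_K / A = q / 4" using kernel_bounds c by (simp_all add: A_def)
  define c' where "c' = c / A"
  have c': "0 < c'" using c A by (simp add: c'_def)
  define err where "err n \<omega> = bias_term L F K x (h n) n (\<lambda>i. X i \<omega>)
    + noise_term L G \<kappa> K x (h n) n (\<lambda>i. X i \<omega>) (\<lambda>i. Y i \<omega>)" for n \<omega>
  have err_measurable [measurable]: "err n \<in> borel_measurable M" for n
    unfolding err_def by (rule error_measurable[OF bandwidth(1)])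
  have R_measurable [measurable]: "R n \<in> borel_measurable M" for n
    using remainder unfolding little_o_prob_def by blast
  have "(\<lambda>n. prob {\<omega>\<in>space M. norm (R n \<omega>) > c' / 2 * \<delta> n}) \<longlonglongrightarrow> 0"
    unfolding \<delta>_def s_def
    by (rule remainder[unfolded little_o_prob_def, THEN conjunct2, rule_format]) (use c' in simp)
  then have "\<forall>\<^sub>F n in sequentially. prob {\<omega>\<in>space M. norm (R n \<omega>) > c' / 2 * \<delta> n} < q / 4"
    using c by (intro order_tendstoD(2)) auto
  moreover have "\<forall>\<^sub>F n in sequentially. 0 < s n"
    using bandwidth(3) unfolding filterlim_at_top_dense s_def by blast
  \<comment> \<open>The denominator and the remainder each cost \<open>q / 4\<close>, which leaves
    \<open>q / 2\<close>. The remainder takes at most half of \<open>c' * \<delta> n\<close>, and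
    \<open>c' / 3\<close> in place of \<open>c' / 2\<close> makes the inequality strict.\<close>
  ultimately have "\<forall>\<^sub>F n in sequentially. q / 2 \<le> prob {\<omega>\<in>space M.
           ball_exponent_inv C2 t2 t3 (ln (real n)) powr (- \<beta>) *
             norm (\<Theta> (weighted_empirical N K x (h n) n (\<lambda>i. X i \<omega>) (\<lambda>i. Y i \<omega>)) - \<Theta> (\<kappa> x))
           > c' / 3 * a powr \<beta>}"
    using sum_lower bandwidth_lower
  proof eventually_elim
    case (elim n)
    define r where "r = ball_exponent_inv C2 t2 t3 (ln (real n))"
    have r: "0 < r" "a * r \<le> h n" using elim(4) by (simp_all add: r_def)
    have \<delta>: "0 < \<delta> n" using bandwidth(1)[of n] by (simp add: \<delta>_def less_max_iff_disj)
    note [measurable] = weighted_sum_measurable[OF bandwidth(1)] total_weight_measurable[OF bandwidth(1)]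
    define E1 where "E1 = {\<omega>\<in>space M. c * (\<delta> n * s n) \<le> norm (weighted_sum (h n) n \<omega>)}"
    define E2 where "E2 = {\<omega>\<in>space M. A * s n \<le> total_weight (h n) n \<omega>}"
    define E3 where "E3 = {\<omega>\<in>space M. c' * \<delta> n \<le> norm (err n \<omega>)}"
    define E4 where "E4 = {\<omega>\<in>space M. norm (R n \<omega>) > c' / 2 * \<delta> n}"
    define E5 where "E5 = {\<omega>\<in>space M. r powr (- \<beta>) * norm (err n \<omega> + R n \<omega>) > c' / 3 * a powr \<beta>}"
    have E [measurable]: "E1 \<in> events" "E2 \<in> events" "E3 \<in> events" "E4 \<in> events" "E5 \<in> events"
      unfolding E1_def E2_def E3_def E4_def E5_def by measurable
    have "E1 \<subseteq> E2 \<union> E3"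
    proof
      fix \<omega> assume \<omega>: "\<omega> \<in> E1"
      show "\<omega> \<in> E2 \<union> E3"
      proof (cases "\<omega> \<in> E2")
        case False
        then have "total_weight (h n) n \<omega> < A * s n" using \<omega> by (auto simp: E1_def E2_def)
        moreover have "c * \<delta> n * s n \<le> norm (weighted_sum (h n) n \<omega>)" using \<omega> by (simp add: E1_def mult.assoc)
        ultimately have "c * \<delta> n / A \<le> norm (err n \<omega>)"
          unfolding err_def using c \<delta> elim(2) A by (intro norm_error_ge[OF bandwidth(1)]) auto
        then show ?thesis using \<omega> by (simp add: E1_def E3_def c'_def)
      qed simp
    qed
    then have "prob E1 - prob E2 \<le> prob E3" by (intro prob_ge_diff E)
    moreover have "prob E2 \<le> q / 4"
      using prob_total_weight_ge[OF bandwidth(1) _ A(1), of n n] elim(2) A(2) by (simp add: E2_def s_def)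
    moreover have "q \<le> prob E1" using elim(3) by (simp add: E1_def)
    moreover have "prob E4 \<le> q / 4" using elim(1) by (simp add: E4_def)
    moreover have "prob E3 - prob E4 \<le> prob E5"
    proof (rule prob_ge_diff[OF E(3,4,5)], rule subsetI)
      fix \<omega> assume \<omega>: "\<omega> \<in> E3"
      show "\<omega> \<in> E4 \<union> E5"
      proof (cases "\<omega> \<in> E4")
        case False
        then have "norm (R n \<omega>) \<le> c' / 2 * \<delta> n" using \<omega> by (auto simp: E3_def E4_def)
        moreover have "c' * \<delta> n \<le> norm (err n \<omega>)" using \<omega> by (simp add: E3_def)
        moreover have "norm (err n \<omega>) - norm (R n \<omega>) \<le> norm (err n \<omega> + R n \<omega>)"
          by (rule norm_diff_ineq)
        moreover have "0 < c' * \<delta> n" using c' \<delta> by simp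
        ultimately have lower: "c' / 3 * \<delta> n < norm (err n \<omega> + R n \<omega>)" by (simp add: field_simps)
        \<comment> \<open>Only now is \<open>\<delta> n\<close> weakened to
          \<open>h n powr \<beta>\<close>, and this to the reference rate through
          \<open>a * r \<le> h n\<close>.\<close>
        have "a powr \<beta> * r powr \<beta> = (a * r) powr \<beta>" by (simp add: powr_mult)
        also have "\<dots> \<le> h n powr \<beta>" using r a Hoelder(1) by (intro powr_mono2) auto
        also have "\<dots> \<le> \<delta> n" by (simp add: \<delta>_def)
        finally have "c' / 3 * (a powr \<beta> * r powr \<beta>) < norm (err n \<omega> + R n \<omega>)"
          using lower c' by (intro le_less_trans[OF mult_left_mono lower]) auto
        then have "c' / 3 * a powr \<beta> < r powr (- \<beta>) * norm (err n \<omega> + R n \<omega>)"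
          using r by (simp add: powr_minus field_simps)
        then show ?thesis using \<omega> by (simp add: E3_def E5_def)
      qed simp
    qed
    ultimately have "q / 2 \<le> prob E5" by simp
    also have "E5 = {\<omega>\<in>space M. r powr (- \<beta>) *
        norm (\<Theta> (weighted_empirical N K x (h n) n (\<lambda>i. X i \<omega>) (\<lambda>i. Y i \<omega>)) - \<Theta> (\<kappa> x))
        > c' / 3 * a powr \<beta>}"
      unfolding E5_def by (intro Collect_cong conj_cong refl) (simp add: expansion err_def)
    finally show ?case by (simp only: r_def)
  qed
  then have "ereal (q / 2) \<le> liminf (\<lambda>n. ereal (prob {\<omega>\<in>space M.
           ball_exponent_inv C2 t2 t3 (ln (real n)) powr (- \<beta>) *
             norm (\<Theta> (weighted_empirical N K x (h n) n (\<lambda>i. X i \<omega>) (\<lambda>i. Y i \<omega>)) - \<Theta> (\<kappa> x))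
           > c' / 3 * a powr \<beta>}))"
    by (intro Liminf_bounded) simp
  moreover have "0 < ereal (q / 2)" using c by simp
  moreover have "0 < c' / 3 * a powr \<beta>" using c' a by simp
  ultimately show ?thesis by (blast intro: less_le_trans)
qed

end
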